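(* Let $\Gamma$ be a rooted tree on the vertex set $\{x_1,\ldots,x_n\}$, let $\mathbb{K}$ be a field and $R=\mathbb{K}[x_1,\ldots,x_n]$. Then for all $1\le t\le \operatorname{height}(\Gamma)+1$, subadditivity holds for $R/I_t(\Gamma)$.
   Context: A rooted tree is a tree with a fixed vertex (the root); it is viewed as a directed graph by directing each edge away from the root. A directed path of length $t-1$ in $\Gamma$ is a sequence of distinct vertices $x_{i_1},\ldots,x_{i_t}$ such that $(x_{i_j},x_{i_{j+1}})$ is a directed edge (from $x_{i_j}$ to $x_{i_{j+1}}$) for each $1\le j\le t-1$. The $t$-path ideal is $I_t(\Gamma)=(x_{i_1}\cdots x_{i_t} : x_{i_1},\ldots,x_{i_t}\text{ is a directed path of length }t-1\text{ in }\Gamma)\subset R$. The level of a vertex is the length (number of edges) of the unique path from the root to it, and $\operatorname{height}(\Gamma)$ is the maximum level of a vertex. For a finitely generated graded module $M$ over the standard graded ring $R$, $t_i^R(M)=\sup\{j:\beta_{i,j}^R(M)\neq0\}$ (with $\sup\emptyset=-\infty$), and subadditivity holds for $M$ if $t_{a+b}^R(M)\le t_a^R(M)+t_b^R(M)$ for all $a,b\ge0$ with $a+b\le\operatorname{pd}_R(M)$. *)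

theory Defs
  imports
    "HOL-Library.Poly_Mapping"
    "HOL-Library.Extended_Nat"
    "HOL-Library.Extended_Real"
    "HOL-Algebra.Module"
    "HOL-Algebra.QuotRing"
begin

section \<open>Rooted trees\<close>

text \<open>The vertex set is the whole type \<open>'v\<close>, of class \<open>finite\<close> in the statement; an undirected
  graph on it is given by its set of edges, which are two-element sets of vertices.\<close>

definition path_between :: "'v set set \<Rightarrow> 'v \<Rightarrow> 'v \<Rightarrow> 'v list \<Rightarrow> bool" where
  "path_between E u v p \<longleftrightarrow>
     p \<noteq> [] \<and> hd p = u \<and> last p = v \<and> distinct p \<and> successively (\<lambda>x y. {x, y} \<in> E) p"

definition graph_cycle :: "'v set set \<Rightarrow> 'v list \<Rightarrow> bool" where
  "graph_cycle E c \<longleftrightarrow>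
     length c \<ge> 3 \<and> distinct c \<and> successively (\<lambda>x y. {x, y} \<in> E) c \<and> {last c, hd c} \<in> E"

definition is_tree :: "'v set set \<Rightarrow> bool" where
  "is_tree E \<longleftrightarrow>
     (\<forall>e\<in>E. card e = 2) \<and> (\<forall>u v. \<exists>p. path_between E u v p) \<and> (\<nexists>c. graph_cycle E c)"

text \<open>In a tree the path from \<open>\<rho>\<close> to \<open>v\<close> is unique, so \<open>THE\<close> is justified. A list of \<open>k + 1\<close>
  vertices is a path of length \<open>k\<close>.\<close>

definition level :: "'v set set \<Rightarrow> 'v \<Rightarrow> 'v \<Rightarrow> nat" where
  "level E \<rho> v = length (THE p. path_between E \<rho> v p) - 1"

definition tree_height :: "'v::finite set set \<Rightarrow> 'v \<Rightarrow> nat" where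
  "tree_height E \<rho> = Max (range (level E \<rho>))"

definition arc :: "'v set set \<Rightarrow> 'v \<Rightarrow> 'v \<Rightarrow> 'v \<Rightarrow> bool" where
  "arc E \<rho> u v \<longleftrightarrow> {u, v} \<in> E \<and> level E \<rho> u < level E \<rho> v"

definition directed_path :: "'v set set \<Rightarrow> 'v \<Rightarrow> 'v list \<Rightarrow> bool" where
  "directed_path E \<rho> p \<longleftrightarrow> distinct p \<and> successively (arc E \<rho>) p"


section \<open>The standard graded polynomial ring\<close>

type_synonym ('v, 'k) mpoly = "('v \<Rightarrow>\<^sub>0 nat) \<Rightarrow>\<^sub>0 'k"

definition poly_ring :: "('v, 'k::comm_ring_1) mpoly ring" where
  "poly_ring = \<lparr>carrier = UNIV, monoid.mult = (*), one = 1, zero = 0, add = (+)\<rparr>"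

definition var :: "'v \<Rightarrow> ('v, 'k::comm_ring_1) mpoly" where
  "var v = Poly_Mapping.single (Poly_Mapping.single v 1) 1"

text \<open>The component of degree \<open>e\<close>; it is zero for \<open>e < 0\<close>.\<close>

definition homogeneous :: "int \<Rightarrow> ('v::finite, 'k::comm_ring_1) mpoly set" where
  "homogeneous e =
     {p. \<forall>m \<in> Poly_Mapping.keys p. int (\<Sum>v\<in>UNIV. Poly_Mapping.lookup m v) = e}"

definition irrelevant_ideal :: "('v, 'k::comm_ring_1) mpoly set" where
  "irrelevant_ideal = genideal poly_ring (range var)"

definition path_ideal :: "nat \<Rightarrow> 'v set set \<Rightarrow> 'v \<Rightarrow> ('v, 'k::comm_ring_1) mpoly set" where
  "path_ideal t E \<rho> =
     genideal poly_ring {prod_list (map var p) |p. directed_path E \<rho> p \<and> length p = t}"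


section \<open>Modules over the polynomial ring\<close>

text \<open>The record type \<open>module\<close> extends \<open>ring\<close>, but the locale \<open>module\<close> does not use the fields
  \<open>mult\<close> and \<open>one\<close>.\<close>

definition quotient_module ::
    "('v, 'k::comm_ring_1) mpoly set \<Rightarrow> (('v, 'k) mpoly, ('v, 'k) mpoly set) module" where
  "quotient_module I =
     \<lparr>carrier = carrier (poly_ring Quot I),
      monoid.mult = monoid.mult (poly_ring Quot I), one = one (poly_ring Quot I),
      zero = zero (poly_ring Quot I), add = add (poly_ring Quot I),
      smult = (\<lambda>r X. (I +>\<^bsub>poly_ring\<^esub> r) \<otimes>\<^bsub>poly_ring Quot I\<^esub> X)\<rparr>"

definition quotient_grading ::
    "('v::finite, 'k::comm_ring_1) mpoly set \<Rightarrow> int \<Rightarrow> ('v, 'k) mpoly set set" where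
  "quotient_grading I j = (\<lambda>p. I +>\<^bsub>poly_ring\<^esub> p) ` homogeneous j"

text \<open>The free module of rank \<open>r\<close>: coordinate vectors indexed by \<open>0, \<dots>, r - 1\<close>.\<close>

definition free_module ::
    "nat \<Rightarrow> (('v, 'k::comm_ring_1) mpoly, nat \<Rightarrow> ('v, 'k) mpoly) module" where
  "free_module r =
     \<lparr>carrier = {f. \<forall>k\<ge>r. f k = 0}, monoid.mult = undefined, one = undefined,
      zero = (\<lambda>_. 0), add = (\<lambda>f g k. f k + g k), smult = (\<lambda>a f k. a * f k)\<rparr>"

text \<open>For a list \<open>ds\<close> of generator degrees, the component of degree \<open>j\<close> of the graded free module
  \<open>R(-ds!0) \<oplus> \<dots> \<oplus> R(-ds!(r-1))\<close>, where \<open>r = length ds\<close>.\<close>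

definition free_grading ::
    "int list \<Rightarrow> int \<Rightarrow> (nat \<Rightarrow> ('v::finite, 'k::comm_ring_1) mpoly) set" where
  "free_grading ds j =
     {f \<in> carrier (free_module (length ds)). \<forall>k<length ds. f k \<in> homogeneous (j - ds ! k)}"

definition linear_maps ::
    "('r, 'x) ring_scheme \<Rightarrow> ('r, 'a, 'y) module_scheme \<Rightarrow> ('r, 'b, 'z) module_scheme \<Rightarrow> ('a \<Rightarrow> 'b) set"
  where
  "linear_maps R M N =
     {h \<in> carrier M \<rightarrow> carrier N.
        (\<forall>x\<in>carrier M. \<forall>y\<in>carrier M. h (x \<oplus>\<^bsub>M\<^esub> y) = h x \<oplus>\<^bsub>N\<^esub> h y) \<and>
        (\<forall>a\<in>carrier R. \<forall>x\<in>carrier M. h (a \<odot>\<^bsub>M\<^esub> x) = a \<odot>\<^bsub>N\<^esub> h x)}"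


section \<open>Resolutions, Betti numbers and projective dimension\<close>

text \<open>Exactness of
  \<open>\<dots> \<longrightarrow> F 2 \<longrightarrow> F 1 \<longrightarrow> F 0 \<longrightarrow> M \<longrightarrow> 0\<close>
  with maps \<open>\<phi> i : F (i + 1) \<longrightarrow> F i\<close> and augmentation \<open>\<epsilon> : F 0 \<longrightarrow> M\<close>.\<close>

definition resolution ::
    "(('v, 'k::comm_ring_1) mpoly, 'm) module \<Rightarrow> (nat \<Rightarrow> (('v, 'k) mpoly, 'f) module) \<Rightarrow>
     (nat \<Rightarrow> 'f \<Rightarrow> 'f) \<Rightarrow> ('f \<Rightarrow> 'm) \<Rightarrow> bool" where
  "resolution M F \<phi> \<epsilon> \<longleftrightarrow>
     (\<forall>i. Module.module poly_ring (F i)) \<and>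
     \<epsilon> \<in> linear_maps poly_ring (F 0) M \<and>
     (\<forall>i. \<phi> i \<in> linear_maps poly_ring (F (Suc i)) (F i)) \<and>
     \<epsilon> ` carrier (F 0) = carrier M \<and>
     \<phi> 0 ` carrier (F 1) = a_kernel (F 0) M \<epsilon> \<and>
     (\<forall>i. \<phi> (Suc i) ` carrier (F (Suc (Suc i))) = a_kernel (F (Suc i)) (F i) (\<phi> i))"

text \<open>A graded module is a module \<open>M\<close> together with the family \<open>G\<close> of its homogeneous components.
  In a minimal graded free resolution the \<open>i\<close>-th module is free with generator degrees \<open>D i\<close>, all
  maps preserve degrees, and the image of each \<open>\<phi> i\<close> lies in \<open>\<mm> F i\<close>, where \<open>\<mm>\<close> is the ideal
  generated by the variables.\<close>

definition minimal_graded_free_resolution ::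
    "(('v::finite, 'k::comm_ring_1) mpoly, 'm) module \<Rightarrow> (int \<Rightarrow> 'm set) \<Rightarrow> (nat \<Rightarrow> int list) \<Rightarrow>
     (nat \<Rightarrow> (nat \<Rightarrow> ('v, 'k) mpoly) \<Rightarrow> (nat \<Rightarrow> ('v, 'k) mpoly)) \<Rightarrow>
     ((nat \<Rightarrow> ('v, 'k) mpoly) \<Rightarrow> 'm) \<Rightarrow> bool" where
  "minimal_graded_free_resolution M G D \<phi> \<epsilon> \<longleftrightarrow>
     resolution M (\<lambda>i. free_module (length (D i))) \<phi> \<epsilon> \<and>
     (\<forall>j. \<epsilon> ` free_grading (D 0) j \<subseteq> G j) \<and>
     (\<forall>i j. \<phi> i ` free_grading (D (Suc i)) j \<subseteq> free_grading (D i) j) \<and>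
     (\<forall>i. \<forall>f \<in> carrier (free_module (length (D (Suc i)))). \<forall>k<length (D i).
        \<phi> i f k \<in> irrelevant_ideal)"

text \<open>Over a field, every finitely generated graded module has a minimal graded free resolution, and
  the generator degrees occurring in it are unique up to order, so \<open>THE\<close> is justified.\<close>

definition betti ::
    "(('v::finite, 'k::field) mpoly, 'm) module \<Rightarrow> (int \<Rightarrow> 'm set) \<Rightarrow> nat \<Rightarrow> int \<Rightarrow> nat" where
  "betti M G i j =
     (THE b. \<exists>D \<phi> \<epsilon>. minimal_graded_free_resolution M G D \<phi> \<epsilon> \<and> b = count_list (D i) j)"

text \<open>In \<open>ereal\<close> the supremum of the empty set is \<open>-\<infinity>\<close>.\<close>

definition max_shift ::
    "(('v::finite, 'k::field) mpoly, 'm) module \<Rightarrow> (int \<Rightarrow> 'm set) \<Rightarrow> nat \<Rightarrow> ereal" where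
  "max_shift M G i = (SUP j \<in> {j. betti M G i j \<noteq> 0}. ereal (real_of_int j))"

text \<open>Finitely generated projective modules, as direct summands of free modules of finite rank.\<close>

definition fg_projective :: "(('v, 'k::comm_ring_1) mpoly, 'p) module \<Rightarrow> bool" where
  "fg_projective P \<longleftrightarrow>
     Module.module poly_ring P \<and>
     (\<exists>r. \<exists>s \<in> linear_maps poly_ring P (free_module r). \<exists>q \<in> linear_maps poly_ring (free_module r) P.
        \<forall>x\<in>carrier P. q (s x) = x)"

text \<open>The least length of a projective resolution, \<open>\<infinity>\<close> if there is no finite one. The module \<open>M\<close> is
  meant to be finitely generated over a Noetherian ring, so that it suffices to consider finitely
  generated projective modules; each of these has an isomorphic copy whose elements are coordinate
  vectors, so nothing is lost by fixing the type of the elements.\<close>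

definition proj_dim :: "(('v, 'k::field) mpoly, 'm) module \<Rightarrow> enat" where
  "proj_dim M =
     Inf {enat n |n. \<exists>(P :: nat \<Rightarrow> (('v, 'k) mpoly, nat \<Rightarrow> ('v, 'k) mpoly) module) \<psi> \<epsilon>.
            resolution M P \<psi> \<epsilon> \<and> (\<forall>i. fg_projective (P i)) \<and>
            (\<forall>i>n. carrier (P i) = {\<zero>\<^bsub>P i\<^esub>})}"

definition subadditivity_holds ::
    "(('v::finite, 'k::field) mpoly, 'm) module \<Rightarrow> (int \<Rightarrow> 'm set) \<Rightarrow> bool" where
  "subadditivity_holds M G \<longleftrightarrow>
     (\<forall>a b. enat (a + b) \<le> proj_dim M \<longrightarrow> max_shift M G (a + b) \<le> max_shift M G a + max_shift M G b)"

end

(*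
  Only the vertical structure of the tree matters: if b is a vertex of largest level in a union of
  directed paths, the paths through b, cut off below b, form a chain under inclusion. So among the
  generators through b only the smallest one, m, is needed, and its variable b occurs in no other
  generator. Hence I = J + (m) with J free of b, and the mapping cone of the comparison map
  between the minimal resolutions of R/(J : m)(-deg m) and R/J is minimal, because that map can be
  chosen divisible by the variable b. The shifts of R/I in step i are therefore those of R/J in
  step i together with deg m plus those of R/(J : m) in step i - 1, and J : m again comes from a
  family of this kind, with the vertices of m deleted.

  Setting a variable to 1 does not increase maximal shifts; for the variable b itself this follows
  from the mapping cone of J and m/b, which need not be minimal but still bounds the Betti numbers.
  Thus t_j(J : m) <= t_j(J) <= t_j(I), and by induction
  t_(i+j)(I) <= max(t_(i+j)(J), deg m + t_(i-1)(J : m) + t_j(J : m)) <= t_i(I) + t_j(I).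
*)
theory Submission
  imports Defs "HOL-Library.Function_Algebras"
begin

section \<open>Graded components of polynomials\<close>

text \<open>Path ideals alone do not carry an induction: deleting the vertices of m leaves sets that
  need not be paths. What survives deletion and passage to subfamilies is the property
  \<open>nested\<close>, phrased with levels only; the main inductions run over the number of
  members of such a family. Members may contain each other, so J : m can be the unit ideal, which is
  a base case besides the zero ideal.

  The comparison map is divisible by b because b occurs in no generator of J: hence J : m = J :
  (m/b), multiplication by m/b already lifts to the resolutions, and b times that lift covers
  multiplication by m. The same cones yield the existence of the minimal resolutions.

  The Betti numbers are given by a definite description, so uniqueness has to be proved as well. One
  inequality serves twice: in each step and degree a minimal resolution has at most as many
  generators as any graded free resolution of the same module. It gives uniqueness by antisymmetry,
  and it turns a cone that is not minimal into an upper bound.\<close>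

definition mdeg :: "('v::finite \<Rightarrow>\<^sub>0 nat) \<Rightarrow> int" where
  "mdeg u = int (\<Sum>v\<in>UNIV. Poly_Mapping.lookup u v)"

lemma mdeg_add: "mdeg (u + w) = mdeg u + mdeg w"
  by (simp add: mdeg_def lookup_add sum.distrib)

lemma mdeg_0 [simp]: "mdeg 0 = 0"
  by (simp add: mdeg_def)

lemma homogeneous_iff: "p \<in> homogeneous e \<longleftrightarrow> (\<forall>u\<in>Poly_Mapping.keys p. mdeg u = e)"
  by (simp add: homogeneous_def mdeg_def)

lemma homogeneous_0 [simp]: "0 \<in> homogeneous e"
  by (simp add: homogeneous_iff)

lemma homogeneous_1 [simp]: "1 \<in> homogeneous 0"
  by (simp add: homogeneous_iff)

lemma homogeneous_add: "p \<in> homogeneous e \<Longrightarrow> q \<in> homogeneous e \<Longrightarrow> p + q \<in> homogeneous e"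
  using Poly_Mapping.keys_add[of p q] by (auto simp: homogeneous_iff)

lemma homogeneous_uminus: "p \<in> homogeneous e \<Longrightarrow> - p \<in> homogeneous e"
  by (simp add: homogeneous_iff)

lemma homogeneous_mult:
  "p \<in> homogeneous d \<Longrightarrow> q \<in> homogeneous e \<Longrightarrow> p * q \<in> homogeneous (d + e)"
  using keys_mult[of p q] by (force simp: homogeneous_iff mdeg_add)

lemma homogeneous_sum: "(\<And>k. k \<in> A \<Longrightarrow> f k \<in> homogeneous e) \<Longrightarrow> sum f A \<in> homogeneous e"
  by (induction A rule: infinite_finite_induct) (auto intro: homogeneous_add)

lemma homogeneous_single: "mdeg u = e \<Longrightarrow> Poly_Mapping.single u c \<in> homogeneous e"
  by (auto simp: homogeneous_iff)

lift_definition hcomp :: "int \<Rightarrow> ('v::finite, 'k::zero) mpoly \<Rightarrow> ('v, 'k) mpoly"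
  is "\<lambda>e p u. if mdeg u = e then p u else 0"
  by (rule finite_subset) auto

lemma hcomp_add: "hcomp e (p + q) = hcomp e p + hcomp e (q :: ('v::finite, 'k::comm_ring_1) mpoly)"
  by (rule poly_mapping_eqI) (simp add: hcomp.rep_eq lookup_add)

lemma hcomp_0 [simp]: "hcomp e 0 = 0"
  by (rule poly_mapping_eqI) (simp add: hcomp.rep_eq)

lemma hcomp_diff: "hcomp e (p - q) = hcomp e p - hcomp e (q :: ('v::finite, 'k::comm_ring_1) mpoly)"
  by (rule poly_mapping_eqI) (simp add: hcomp.rep_eq lookup_minus)

lemma hcomp_sum: "hcomp e (sum f A) = (\<Sum>k\<in>A. hcomp e (f k :: ('v::finite, 'k::comm_ring_1) mpoly))"
  by (induction A rule: infinite_finite_induct) (auto simp: hcomp_add)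

lemma hcomp_homogeneous [simp]: "hcomp e p \<in> homogeneous e"
  by (auto simp: homogeneous_iff in_keys_iff hcomp.rep_eq split: if_splits)

lemma hcomp_of_homogeneous: "p \<in> homogeneous d \<Longrightarrow> hcomp e p = (if e = d then p else 0)"
  by (intro poly_mapping_eqI) (auto simp: homogeneous_iff in_keys_iff hcomp.rep_eq)

lemma mpoly_sum_monomials: "(\<Sum>u\<in>Poly_Mapping.keys p. Poly_Mapping.single u (Poly_Mapping.lookup p u)) = p"
  by (rule poly_mapping_eqI)
    (auto simp: lookup_sum lookup_single when_def in_keys_iff sum.delta')

text \<open>Both sides are linear in \<open>p\<close>, so \<open>p\<close> may be taken to be a
  monomial; then the product is homogeneous and either survives as a whole or vanishes.\<close>

lemma hcomp_mult:
  fixes p q :: "('v::finite, 'k::comm_ring_1) mpoly"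
  assumes "q \<in> homogeneous d"
  shows "hcomp e (p * q) = hcomp (e - d) p * q"
proof -
  have *: "hcomp e (Poly_Mapping.single u c * q) = hcomp (e - d) (Poly_Mapping.single u c) * q" for u c
  proof -
    have "Poly_Mapping.single u c * q \<in> homogeneous (mdeg u + d)"
      by (intro homogeneous_mult homogeneous_single assms refl)
    thus ?thesis
      using homogeneous_single[of u "mdeg u" c] by (auto simp: hcomp_of_homogeneous)
  qed
  have "hcomp e (p * q) = hcomp e ((\<Sum>u\<in>Poly_Mapping.keys p. Poly_Mapping.single u (Poly_Mapping.lookup p u)) * q)"
    by (simp add: mpoly_sum_monomials)
  also have "\<dots> = hcomp (e - d) (\<Sum>u\<in>Poly_Mapping.keys p. Poly_Mapping.single u (Poly_Mapping.lookup p u)) * q"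
    by (simp add: sum_distrib_right hcomp_sum *)
  finally show ?thesis by (simp add: mpoly_sum_monomials)
qed

text \<open>The residue map from R to its quotient by the irrelevant ideal. Applying it to the
  entries of a matrix replaces tensoring a complex with the ground field.\<close>

definition const_coeff :: "('v, 'k::zero) mpoly \<Rightarrow> 'k" where
  "const_coeff p = Poly_Mapping.lookup p 0"

lemma const_coeff_add: "const_coeff (p + q) = const_coeff p + const_coeff q"
  by (simp add: const_coeff_def lookup_add)

lemma const_coeff_0 [simp]: "const_coeff 0 = 0"
  by (simp add: const_coeff_def)

lemma const_coeff_1 [simp]: "const_coeff 1 = 1"
  by (simp add: const_coeff_def)

lemma const_coeff_uminus: "const_coeff (- p) = - const_coeff p"
  by (simp add: const_coeff_def)

lemma const_coeff_diff: "const_coeff (p - q) = const_coeff p - const_coeff q"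
  by (simp add: const_coeff_def lookup_minus)

lemma const_coeff_sum: "const_coeff (sum f A) = (\<Sum>k\<in>A. const_coeff (f k))"
  by (simp add: const_coeff_def lookup_sum)

text \<open>Exponents are natural numbers, so a product of monomials is constant only if both
  factors are.\<close>

lemma const_coeff_mult:
  fixes p q :: "('v::finite, 'k::comm_ring_1) mpoly"
  shows "const_coeff (p * q) = const_coeff p * const_coeff q"
proof -
  have nz: "u + w = 0 \<longleftrightarrow> u = 0 \<and> w = 0" for u w :: "'v \<Rightarrow>\<^sub>0 nat"
    by (auto simp: poly_mapping_eq_iff lookup_add fun_eq_iff plus_fun_def)
  have *: "const_coeff (Poly_Mapping.single u c * q) = const_coeff (Poly_Mapping.single u c) * const_coeff q"
    for u c
  proof -
    have q: "q = (\<Sum>w\<in>Poly_Mapping.keys q. Poly_Mapping.single w (Poly_Mapping.lookup q w))"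
      by (simp add: mpoly_sum_monomials)
    have "const_coeff (Poly_Mapping.single u c * q) =
        (\<Sum>w\<in>Poly_Mapping.keys q. const_coeff (Poly_Mapping.single (u + w) (c * Poly_Mapping.lookup q w)))"
      by (subst q) (simp only: sum_distrib_left const_coeff_sum mult_single)
    also have "\<dots> = (\<Sum>w\<in>Poly_Mapping.keys q. const_coeff (Poly_Mapping.single u c) *
        const_coeff (Poly_Mapping.single w (Poly_Mapping.lookup q w)))"
      by (intro sum.cong refl) (auto simp: const_coeff_def lookup_single when_def nz)
    also have "\<dots> = const_coeff (Poly_Mapping.single u c) * const_coeff q"
      by (simp only: sum_distrib_left[symmetric] const_coeff_sum[symmetric] mpoly_sum_monomials)
    finally show ?thesis .
  qed
  have "const_coeff (p * q) = const_coeff ((\<Sum>u\<in>Poly_Mapping.keys p. Poly_Mapping.single u (Poly_Mapping.lookup p u)) * q)"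
    by (simp add: mpoly_sum_monomials)
  also have "\<dots> = const_coeff (\<Sum>u\<in>Poly_Mapping.keys p. Poly_Mapping.single u (Poly_Mapping.lookup p u)) * const_coeff q"
    by (simp only: sum_distrib_right const_coeff_sum *)
  finally show ?thesis by (simp add: mpoly_sum_monomials)
qed

lemma const_coeff_homogeneous: "p \<in> homogeneous e \<Longrightarrow> e \<noteq> 0 \<Longrightarrow> const_coeff p = 0"
  by (metis const_coeff_def homogeneous_iff in_keys_iff mdeg_0)

section \<open>Free modules and graded resolutions\<close>

text \<open>Row vector times matrix, where \<open>Y k\<close> is the image of the
  \<open>k\<close>-th unit vector. Maps between free modules are handled as such lists of images,
  and \<open>comb_comb\<close> is their composition.\<close>

definition comb :: "nat \<Rightarrow> (nat \<Rightarrow> 'a::comm_ring_1) \<Rightarrow> (nat \<Rightarrow> nat \<Rightarrow> 'a) \<Rightarrow> nat \<Rightarrow> 'a" where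
  "comb r f Y = (\<lambda>l. \<Sum>k<r. f k * Y k l)"

definition unit_vec :: "nat \<Rightarrow> nat \<Rightarrow> 'a::comm_ring_1" where
  "unit_vec k = (\<lambda>j. if j = k then 1 else 0)"

definition vecs :: "nat \<Rightarrow> (nat \<Rightarrow> 'a::zero) set" where
  "vecs r = {f. \<forall>k\<ge>r. f k = 0}"

lemma comb_add: "comb r (f + g) Y = comb r f Y + comb r g Y"
  by (auto simp: comb_def fun_eq_iff distrib_right sum.distrib)

lemma comb_diff: "comb r (f - g) Y = comb r f Y - comb r g Y"
  by (auto simp: comb_def fun_eq_iff left_diff_distrib sum_subtractf)

lemma comb_0 [simp]: "comb r 0 Y = 0"
  by (auto simp: comb_def fun_eq_iff)

lemma comb_0_right [simp]: "comb r f 0 = 0"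
  by (auto simp: comb_def fun_eq_iff)

lemma comb_scale: "comb r (\<lambda>k. a * f k) Y = (\<lambda>l. a * comb r f Y l)"
  by (auto simp: comb_def fun_eq_iff sum_distrib_left mult.assoc)

lemma comb_diff_right: "comb r f (\<lambda>k. Y k - Z k) = comb r f Y - comb r f Z"
  by (auto simp: comb_def fun_eq_iff right_diff_distrib sum_subtractf)

lemma comb_cong: "(\<And>k. k < r \<Longrightarrow> Y k = Z k) \<Longrightarrow> comb r f Y = comb r f Z"
  by (auto simp: comb_def fun_eq_iff)

lemma comb_comb: "comb s (comb r f Y) Z = comb r f (\<lambda>k. comb s (Y k) Z)"
proof
  fix l
  have "comb s (comb r f Y) Z l = (\<Sum>j<s. \<Sum>k<r. f k * (Y k j * Z j l))"
    by (simp add: comb_def sum_distrib_right mult.assoc)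
  also have "\<dots> = (\<Sum>k<r. \<Sum>j<s. f k * (Y k j * Z j l))"
    by (rule sum.swap)
  finally show "comb s (comb r f Y) Z l = comb r f (\<lambda>k. comb s (Y k) Z) l"
    by (simp add: comb_def sum_distrib_left)
qed

lemma comb_unit_vec [simp]: "k < r \<Longrightarrow> comb r (unit_vec k) Y = Y k"
  by (auto simp: comb_def unit_vec_def fun_eq_iff if_distrib[of "\<lambda>x. x * _"] cong: if_cong)

lemma comb_unit_vecs [simp]: "f \<in> vecs r \<Longrightarrow> comb r f unit_vec = f"
  by (auto simp: comb_def unit_vec_def vecs_def fun_eq_iff if_distrib[of "\<lambda>x. _ * x"] not_less cong: if_cong)

lemma unit_vec_in_vecs: "k < r \<Longrightarrow> unit_vec k \<in> vecs r"
  by (auto simp: unit_vec_def vecs_def)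

lemma vecs_add: "f \<in> vecs r \<Longrightarrow> g \<in> vecs r \<Longrightarrow> f + g \<in> vecs r" for f g :: "nat \<Rightarrow> 'a::comm_ring_1"
  by (auto simp: vecs_def)

lemma vecs_diff: "f \<in> vecs r \<Longrightarrow> g \<in> vecs r \<Longrightarrow> f - g \<in> vecs r" for f g :: "nat \<Rightarrow> 'a::comm_ring_1"
  by (auto simp: vecs_def)

lemma vecs_0 [simp]: "0 \<in> vecs r"
  by (auto simp: vecs_def)

lemma comb_in_vecs: "(\<And>k. k < r \<Longrightarrow> Y k \<in> vecs s) \<Longrightarrow> comb r f Y \<in> vecs s"
  by (auto simp: comb_def vecs_def intro!: sum.neutral)

lemma carrier_free_module: "carrier (free_module r) = vecs r"
  by (simp add: free_module_def vecs_def)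

lemma free_grading_iff:
  "f \<in> free_grading ds j \<longleftrightarrow> f \<in> vecs (length ds) \<and> (\<forall>k<length ds. f k \<in> homogeneous (j - ds ! k))"
  by (simp add: free_grading_def carrier_free_module)

lemma free_grading_in_vecs: "f \<in> free_grading ds j \<Longrightarrow> f \<in> vecs (length ds)"
  by (simp add: free_grading_iff)

lemma comb_in_free_grading:
  assumes f: "f \<in> free_grading ds j"
    and Y: "\<And>k. k < length ds \<Longrightarrow> Y k \<in> free_grading es (ds ! k + e)"
  shows "comb (length ds) f Y \<in> free_grading es (j + e)"
  unfolding free_grading_iff
proof (intro conjI allI impI)
  show "comb (length ds) f Y \<in> vecs (length es)"
    using Y by (intro comb_in_vecs free_grading_in_vecs)
  fix l assume l: "l < length es"
  have "f k * Y k l \<in> homogeneous (j + e - es ! l)" if "k < length ds" for k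
  proof -
    have "f k * Y k l \<in> homogeneous ((j - ds ! k) + (ds ! k + e - es ! l))"
      using f Y[OF that] l that by (intro homogeneous_mult) (auto simp: free_grading_iff)
    thus ?thesis by (simp add: algebra_simps)
  qed
  thus "comb (length ds) f Y l \<in> homogeneous (j + e - es ! l)"
    by (auto simp: comb_def intro: homogeneous_sum)
qed

section \<open>Homogeneous components of vectors, graded ideals\<close>

definition hcomp_vec :: "int list \<Rightarrow> int \<Rightarrow> (nat \<Rightarrow> ('v::finite, 'k::comm_ring_1) mpoly) \<Rightarrow> nat \<Rightarrow> ('v, 'k) mpoly" where
  "hcomp_vec ds j f = (\<lambda>k. if k < length ds then hcomp (j - ds ! k) (f k) else 0)"

lemma hcomp_vec_in_free_grading: "hcomp_vec ds j f \<in> free_grading ds j"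
  by (auto simp: free_grading_iff hcomp_vec_def vecs_def)

lemma hcomp_vec_diff: "hcomp_vec ds j (f - g) = hcomp_vec ds j f - hcomp_vec ds j g"
  by (auto simp: hcomp_vec_def hcomp_diff fun_eq_iff)

lemma hcomp_vec_of_free_grading: "f \<in> free_grading ds j \<Longrightarrow> hcomp_vec ds j f = f"
  by (auto simp: hcomp_vec_def free_grading_iff vecs_def hcomp_of_homogeneous fun_eq_iff)

text \<open>The entry \<open>Y k l\<close> is homogeneous of degree \<open>ds ! k - es ! l\<close>,
  so the matrix is a map of degree 0 and commutes with taking components.\<close>

lemma hcomp_vec_comb:
  assumes Y: "\<And>k. k < length ds \<Longrightarrow> Y k \<in> free_grading es (ds ! k)"
  shows "hcomp_vec es j (comb (length ds) f Y) = comb (length ds) (hcomp_vec ds j f) Y"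
proof
  fix l
  show "hcomp_vec es j (comb (length ds) f Y) l = comb (length ds) (hcomp_vec ds j f) Y l"
  proof (cases "l < length es")
    case True
    have "hcomp (j - es ! l) (f k * Y k l) = hcomp (j - ds ! k) (f k) * Y k l" if "k < length ds" for k
      using Y[OF that] True by (subst hcomp_mult[of _ "ds ! k - es ! l"]) (auto simp: free_grading_iff)
    thus ?thesis using True by (simp add: hcomp_vec_def comb_def hcomp_sum)
  next
    case False
    hence "Y k l = 0" if "k < length ds" for k
      using Y[OF that] by (auto simp: free_grading_iff vecs_def)
    thus ?thesis using False by (simp add: hcomp_vec_def comb_def)
  qed
qed

text \<open>Closure under homogeneous components stands for generation by homogeneous elements. The
  ring record is avoided here; \<open>graded_ideal_ideal\<close> makes the connection.\<close>

definition graded_ideal :: "('v::finite, 'k::comm_ring_1) mpoly set \<Rightarrow> bool" where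
  "graded_ideal J \<longleftrightarrow> 0 \<in> J \<and> (\<forall>p\<in>J. \<forall>q\<in>J. p + q \<in> J) \<and> (\<forall>p\<in>J. \<forall>q. q * p \<in> J) \<and>
     (\<forall>p\<in>J. \<forall>e. hcomp e p \<in> J)"

lemma graded_ideal_diff: "graded_ideal J \<Longrightarrow> p \<in> J \<Longrightarrow> q \<in> J \<Longrightarrow> p - q \<in> J"
  unfolding graded_ideal_def by (metis diff_conv_add_uminus mult_minus1)

lemma graded_ideal_sum: "graded_ideal J \<Longrightarrow> (\<And>k. k \<in> A \<Longrightarrow> f k \<in> J) \<Longrightarrow> sum f A \<in> J"
  by (induction A rule: infinite_finite_induct) (auto simp: graded_ideal_def)

text \<open>The resolutions of \<open>R/J\<close> below are augmented by \<open>R\<close> in position \<open>0\<close>, where exactness is meant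
  modulo \<open>J\<close>; so position \<open>i + 1\<close> holds the free module \<open>F i\<close> of the definition in the statement.
  The list \<open>C i\<close> contains the generator degrees in position \<open>i\<close>, and \<open>\<Phi> i k\<close> is the image of the
  \<open>k\<close>-th generator of position \<open>i + 1\<close>.\<close>

definition relations :: "('v::finite, 'k::comm_ring_1) mpoly set \<Rightarrow> nat \<Rightarrow> (nat \<Rightarrow> ('v, 'k) mpoly) set" where
  "relations J i = (if i = 0 then {f \<in> vecs 1. f 0 \<in> J} else {0})"

lemma relations_Suc [simp]: "relations J (Suc i) = {0}"
  by (simp add: relations_def)

lemma relations_0 [simp]: "graded_ideal J \<Longrightarrow> 0 \<in> relations J i"
  by (simp add: relations_def graded_ideal_def)

lemma relations_add: "graded_ideal J \<Longrightarrow> f \<in> relations J i \<Longrightarrow> g \<in> relations J i \<Longrightarrow> f + g \<in> relations J i"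
  by (auto simp: relations_def graded_ideal_def vecs_add split: if_splits)

lemma relations_diff: "graded_ideal J \<Longrightarrow> f \<in> relations J i \<Longrightarrow> g \<in> relations J i \<Longrightarrow> f - g \<in> relations J i"
  by (auto simp: relations_def graded_ideal_diff vecs_diff split: if_splits)

lemma relations_uminus: "graded_ideal J \<Longrightarrow> f \<in> relations J i \<Longrightarrow> - f \<in> relations J i"
  using relations_diff[of J 0 i f] by simp

lemma relations_comb:
  assumes J: "graded_ideal J" and Y: "\<And>k. k < r \<Longrightarrow> Y k \<in> relations J i"
  shows "comb r f Y \<in> relations J i"
proof (cases i)
  case 0
  have "comb r f Y \<in> vecs 1"
    using Y 0 by (intro comb_in_vecs) (auto simp: relations_def)
  moreover have "comb r f Y 0 \<in> J"
    using Y 0 J unfolding comb_def by (intro graded_ideal_sum) (auto simp: graded_ideal_def relations_def)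
  ultimately show ?thesis by (simp add: relations_def 0)
next
  case (Suc n)
  have "comb r f Y = comb r f 0" using Y Suc by (intro comb_cong) simp
  thus ?thesis by (simp add: Suc)
qed

lemma relations_hcomp_vec:
  assumes "graded_ideal J" "f \<in> relations J i"
  shows "i = 0 \<Longrightarrow> hcomp_vec [0] d f \<in> relations J i" "i \<noteq> 0 \<Longrightarrow> hcomp_vec ds d f \<in> relations J i"
  using assms by (auto simp: relations_def hcomp_vec_def vecs_def graded_ideal_def fun_eq_iff)

text \<open>The equivalence in the last clause holds both halves of exactness: from left to right
  cycles are boundaries, from right to left consecutive maps compose to zero (at position 0 modulo
  \<open>J\<close>). The clause before it is surjectivity onto R/J. A finite resolution continues
  with empty lists.\<close>

definition graded_resolution :: "('v::finite, 'k::comm_ring_1) mpoly set \<Rightarrow> (nat \<Rightarrow> int list) \<Rightarrow>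
    (nat \<Rightarrow> nat \<Rightarrow> nat \<Rightarrow> ('v, 'k) mpoly) \<Rightarrow> bool" where
  "graded_resolution J C \<Phi> \<longleftrightarrow> C 0 = [0] \<and>
     (\<forall>i. \<forall>k<length (C (Suc i)). \<Phi> i k \<in> free_grading (C i) (C (Suc i) ! k)) \<and>
     (\<forall>f\<in>vecs 1. \<exists>g\<in>vecs (length (C (Suc 0))). f - comb (length (C (Suc 0))) g (\<Phi> 0) \<in> relations J 0) \<and>
     (\<forall>i. \<forall>f\<in>vecs (length (C (Suc i))). comb (length (C (Suc i))) f (\<Phi> i) \<in> relations J i \<longleftrightarrow>
        (\<exists>g\<in>vecs (length (C (Suc (Suc i)))). f = comb (length (C (Suc (Suc i)))) g (\<Phi> (Suc i))))"

text \<open>The condition starts at \<open>\<Phi> 1\<close>. The map \<open>\<Phi> 0\<close> is the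
  augmentation into R, which normally sends a generator to a unit.\<close>

definition minimal_cols :: "(nat \<Rightarrow> int list) \<Rightarrow> (nat \<Rightarrow> nat \<Rightarrow> nat \<Rightarrow> ('v, 'k::zero) mpoly) \<Rightarrow> bool" where
  "minimal_cols C \<Phi> \<longleftrightarrow> (\<forall>i. \<forall>k<length (C (Suc (Suc i))). \<forall>l. const_coeff (\<Phi> (Suc i) k l) = 0)"

lemma graded_resolution_0: "graded_resolution J C \<Phi> \<Longrightarrow> C 0 = [0]"
  by (simp add: graded_resolution_def)

lemma graded_resolution_graded: "graded_resolution J C \<Phi> \<Longrightarrow> k < length (C (Suc i)) \<Longrightarrow> \<Phi> i k \<in> free_grading (C i) (C (Suc i) ! k)"
  by (simp add: graded_resolution_def)

lemma graded_resolution_vecs: "graded_resolution J C \<Phi> \<Longrightarrow> k < length (C (Suc i)) \<Longrightarrow> \<Phi> i k \<in> vecs (length (C i))"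
  by (blast dest: graded_resolution_graded free_grading_in_vecs)

lemma graded_resolution_surj:
  "graded_resolution J C \<Phi> \<Longrightarrow> f \<in> vecs (Suc 0) \<Longrightarrow>
     \<exists>g\<in>vecs (length (C (Suc 0))). f - comb (length (C (Suc 0))) g (\<Phi> 0) \<in> relations J 0"
  by (simp add: graded_resolution_def)

lemma graded_resolution_exact:
  "graded_resolution J C \<Phi> \<Longrightarrow> f \<in> vecs (length (C (Suc i))) \<Longrightarrow> comb (length (C (Suc i))) f (\<Phi> i) \<in> relations J i \<Longrightarrow>
     \<exists>g\<in>vecs (length (C (Suc (Suc i)))). f = comb (length (C (Suc (Suc i)))) g (\<Phi> (Suc i))"
  by (simp add: graded_resolution_def)

lemma graded_resolution_complex_col:
  assumes "graded_resolution J C \<Phi>" "k < length (C (Suc (Suc i)))"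
  shows "comb (length (C (Suc i))) (\<Phi> (Suc i) k) (\<Phi> i) \<in> relations J i"
proof -
  have "\<exists>g\<in>vecs (length (C (Suc (Suc i)))). \<Phi> (Suc i) k = comb (length (C (Suc (Suc i)))) g (\<Phi> (Suc i))"
    by (rule bexI[of _ "unit_vec k"]) (simp_all add: assms unit_vec_in_vecs)
  thus ?thesis
    using assms graded_resolution_vecs[OF assms] unfolding graded_resolution_def by blast
qed

lemma graded_resolution_complex:
  assumes "graded_resolution J C \<Phi>" "graded_ideal J"
  shows "comb (length (C (Suc i))) (comb (length (C (Suc (Suc i)))) f (\<Phi> (Suc i))) (\<Phi> i) \<in> relations J i"
  unfolding comb_comb by (intro relations_comb assms(2) graded_resolution_complex_col[OF assms(1)])

text \<open>The component of degree \<open>d\<close> of any preimage will do: the maps commute with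
  taking components, and the relations are closed under it.\<close>

lemma graded_resolution_homogeneous_preimage:
  assumes C: "graded_resolution J C \<Phi>" and J: "graded_ideal J" and w: "w \<in> free_grading (C i) d"
    and y: "comb (length (C (Suc i))) y (\<Phi> i) - w \<in> relations J i"
  shows "\<exists>y'\<in>free_grading (C (Suc i)) d. comb (length (C (Suc i))) y' (\<Phi> i) - w \<in> relations J i"
proof (rule bexI[OF _ hcomp_vec_in_free_grading])
  let ?y = "hcomp_vec (C (Suc i)) d y"
  have eq: "hcomp_vec (C i) d (comb (length (C (Suc i))) y (\<Phi> i) - w) = comb (length (C (Suc i))) ?y (\<Phi> i) - w"
    using w by (simp add: hcomp_vec_diff hcomp_vec_of_free_grading hcomp_vec_comb[OF graded_resolution_graded[OF C]])
  show "comb (length (C (Suc i))) ?y (\<Phi> i) - w \<in> relations J i"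
    unfolding eq[symmetric] using relations_hcomp_vec[OF J y] graded_resolution_0[OF C] by (cases "i = 0") simp_all
qed

lemma relations_eq_diff: "graded_ideal J \<Longrightarrow> f - g \<in> relations J i \<Longrightarrow> g \<in> relations J i \<Longrightarrow> f \<in> relations J i"
  using relations_add[of J "f - g" i g] by simp

text \<open>The comparison theorem for multiplication by \<open>m\<close> from R/K to R/J, with
  homogeneous columns. The third conclusion matters only at position 0, where it says that the map
  respects the passage modulo \<open>K\<close> and \<open>J\<close>.\<close>

lemma chain_lift:
  fixes J K :: "('v::finite, 'k::comm_ring_1) mpoly set"
  assumes S: "graded_resolution K S \<Psi>" and C: "graded_resolution J C \<Phi>" and K: "graded_ideal K" and J: "graded_ideal J"
    and m: "m \<in> homogeneous e" and mKJ: "\<And>p. p \<in> K \<Longrightarrow> p * m \<in> J"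
  obtains A where "A 0 = (\<lambda>k l. if k = 0 \<and> l = 0 then m else 0)"
    and "\<And>i k. k < length (S i) \<Longrightarrow> A i k \<in> free_grading (C i) (S i ! k + e)"
    and "\<And>i f. f \<in> relations K i \<Longrightarrow> comb (length (S i)) f (A i) \<in> relations J i"
    and "\<And>i k. k < length (S (Suc i)) \<Longrightarrow>
      comb (length (C (Suc i))) (A (Suc i) k) (\<Phi> i) - comb (length (S i)) (\<Psi> i k) (A i) \<in> relations J i"
proof -
  \<comment> \<open>The last clause, solvability of the next lifting problem, belongs to the
    invariant because its reason changes: at position 0 it is surjectivity onto R/J, later it is
    exactness.\<close>
  define P where "P i B \<longleftrightarrow> (i = 0 \<longrightarrow> B = (\<lambda>k l. if k = 0 \<and> l = 0 then m else 0)) \<and>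
      (\<forall>k<length (S i). B k \<in> free_grading (C i) (S i ! k + e)) \<and>
      (\<forall>f\<in>relations K i. comb (length (S i)) f B \<in> relations J i) \<and>
      (\<forall>k<length (S (Suc i)). \<exists>y. comb (length (C (Suc i))) y (\<Phi> i) - comb (length (S i)) (\<Psi> i k) B \<in> relations J i)"
    for i B
  define Q where "Q i B B' \<longleftrightarrow> (\<forall>k<length (S (Suc i)).
      comb (length (C (Suc i))) (B' k) (\<Phi> i) - comb (length (S i)) (\<Psi> i k) B \<in> relations J i)" for i B B'
  have base: "P 0 (\<lambda>k l. if k = 0 \<and> l = 0 then m else 0)" (is "P 0 ?B")
  proof -
    have 1: "comb (Suc 0) f ?B \<in> vecs 1" for f
      by (rule comb_in_vecs) (auto simp: vecs_def)
    have "comb (Suc 0) f ?B \<in> relations J 0" if "f \<in> relations K 0" for f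
      using 1 mKJ that by (auto simp: relations_def comb_def)
    moreover have "\<exists>y. comb (length (C (Suc 0))) y (\<Phi> 0) - comb (Suc 0) f ?B \<in> relations J 0" for f
      using graded_resolution_surj[OF C, of "comb (Suc 0) f ?B"] 1[of f] relations_uminus[OF J] by fastforce
    ultimately show ?thesis
      using m by (auto simp: P_def graded_resolution_0[OF S] graded_resolution_0[OF C] free_grading_iff vecs_def)
  qed
  have step: "\<exists>B'. P (Suc i) B' \<and> Q i B B'" if "P i B" for i B
  proof -
    have "\<exists>y\<in>free_grading (C (Suc i)) (S (Suc i) ! k + e).
        comb (length (C (Suc i))) y (\<Phi> i) - comb (length (S i)) (\<Psi> i k) B \<in> relations J i"
      if k: "k < length (S (Suc i))" for k
    proof -
      from \<open>P i B\<close> k obtain y where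
        "comb (length (C (Suc i))) y (\<Phi> i) - comb (length (S i)) (\<Psi> i k) B \<in> relations J i"
        by (auto simp: P_def)
      moreover have "comb (length (S i)) (\<Psi> i k) B \<in> free_grading (C i) (S (Suc i) ! k + e)"
        using \<open>P i B\<close> graded_resolution_graded[OF S k] by (intro comb_in_free_grading) (auto simp: P_def)
      ultimately show ?thesis by (intro graded_resolution_homogeneous_preimage[OF C J])
    qed
    then obtain B' where B': "\<And>k. k < length (S (Suc i)) \<Longrightarrow>
        B' k \<in> free_grading (C (Suc i)) (S (Suc i) ! k + e)"
      "\<And>k. k < length (S (Suc i)) \<Longrightarrow>
        comb (length (C (Suc i))) (B' k) (\<Phi> i) - comb (length (S i)) (\<Psi> i k) B \<in> relations J i"
      by metis
    have "\<exists>y. comb (length (C (Suc (Suc i)))) y (\<Phi> (Suc i)) - comb (length (S (Suc i))) (\<Psi> (Suc i) k) B' \<in> relations J (Suc i)"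
      if k: "k < length (S (Suc (Suc i)))" for k
    proof -
      let ?w = "comb (length (S (Suc i))) (\<Psi> (Suc i) k) B'"
      have "?w \<in> vecs (length (C (Suc i)))"
        using B'(1) by (intro comb_in_vecs) (auto simp: free_grading_iff)
      moreover have "comb (length (C (Suc i))) ?w (\<Phi> i) \<in> relations J i"
      \<comment> \<open>Modulo relations, the image of \<open>?w\<close> is \<open>B\<close> applied
        to two consecutive maps of \<open>S\<close>, which compose to a relation.\<close>
      proof (rule relations_eq_diff[OF J])
        show "comb (length (S i)) (comb (length (S (Suc i))) (\<Psi> (Suc i) k) (\<Psi> i)) B \<in> relations J i"
          using \<open>P i B\<close> graded_resolution_complex_col[OF S k] by (auto simp: P_def)
        show "comb (length (C (Suc i))) ?w (\<Phi> i)
          - comb (length (S i)) (comb (length (S (Suc i))) (\<Psi> (Suc i) k) (\<Psi> i)) B \<in> relations J i"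
          unfolding comb_comb comb_diff_right[symmetric] by (intro relations_comb J B'(2))
      qed
      ultimately obtain g where "?w = comb (length (C (Suc (Suc i)))) g (\<Phi> (Suc i))"
        using graded_resolution_exact[OF C] by blast
      thus ?thesis by (intro exI[of _ g]) simp
    qed
    thus ?thesis using B' by (intro exI[of _ B']) (auto simp: P_def Q_def)
  qed
  from dependent_nat_choice[of P Q] base step
  obtain A where "\<And>i. P i (A i)" "\<And>i. Q i (A i) (A (Suc i))" by metis
  thus ?thesis by (intro that[of A]) (auto simp: P_def Q_def)
qed

section \<open>Comparison of resolutions\<close>

text \<open>A matrix with a right inverse has independent rows, since multiplying a vanishing
  combination of rows by \<open>b\<close> returns its coefficients. The rows lie in the span of
  \<open>card L\<close> unit vectors.\<close>

lemma card_le_of_right_inverse: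
  fixes a :: "'i \<Rightarrow> 'j \<Rightarrow> 'k::field"
  assumes K: "finite K" and L: "finite L"
    and ab: "\<And>k k'. k \<in> K \<Longrightarrow> k' \<in> K \<Longrightarrow> (\<Sum>l\<in>L. a k l * b l k') = (if k = k' then 1 else 0)"
  shows "card K \<le> card L"
proof -
  interpret vs: vector_space "\<lambda>c f. (\<lambda>x. c * f x) :: 'j \<Rightarrow> 'k"
    by unfold_locales (auto simp: fun_eq_iff algebra_simps)
  define e where "e l = (\<lambda>j. if j = l then 1 else 0 :: 'k)" for l :: 'j
  define w where "w k = (\<lambda>l. if l \<in> L then a k l else 0)" for k
  have wb: "(\<Sum>l\<in>L. w k l * b l k') = (if k = k' then 1 else 0)" if "k \<in> K" "k' \<in> K" for k k'
    using ab[OF that] by (simp add: w_def)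
  have inj: "inj_on w K"
    by (rule inj_onI) (metis wb zero_neq_one)
  have sum_apply: "(\<Sum>x\<in>X. g x) l = (\<Sum>x\<in>X. g x l)" for X :: "'x set" and g :: "'x \<Rightarrow> 'j \<Rightarrow> 'k" and l
    by (induction X rule: infinite_finite_induct) auto
  have "vs.independent (w ` K)"
  proof
    assume "vs.dependent (w ` K)"
    then obtain u k' where k': "k' \<in> K" "u (w k') \<noteq> 0"
      and 0: "(\<Sum>v\<in>w ` K. (\<lambda>x. u v * v x)) = 0"
      using K by (auto simp: vs.dependent_finite)
    have *: "(\<Sum>k\<in>K. u (w k) * w k l) = 0" for l
      using fun_cong[OF 0, of l] by (simp add: sum_apply sum.reindex[OF inj])
    have "u (w k') = (\<Sum>k\<in>K. u (w k) * (\<Sum>l\<in>L. w k l * b l k'))"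
      using k' K by (simp add: wb if_distrib[of "\<lambda>x. _ * x"] cong: if_cong)
    also have "\<dots> = (\<Sum>l\<in>L. (\<Sum>k\<in>K. u (w k) * w k l) * b l k')"
      unfolding sum_distrib_left sum_distrib_right by (subst sum.swap) (simp add: mult.assoc)
    also have "\<dots> = 0" by (simp add: *)
    finally show False using k' by simp
  qed
  moreover have "w ` K \<subseteq> vs.span (e ` L)"
  proof
    fix v assume "v \<in> w ` K"
    then obtain k where "v = w k" by auto
    also have "w k = (\<Sum>l\<in>L. (\<lambda>x. a k l * e l x))"
      using L by (auto simp: fun_eq_iff sum_apply w_def e_def if_distrib[of "\<lambda>x. _ * x"] cong: if_cong)
    also have "\<dots> \<in> vs.span (e ` L)"
      by (intro vs.span_sum vs.span_scale vs.span_base imageI)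
    finally show "v \<in> vs.span (e ` L)" .
  qed
  ultimately have "card (w ` K) \<le> card (e ` L)"
    using vs.independent_span_bound[of "e ` L" "w ` K"] L by auto
  thus ?thesis using card_image_le[OF L, of e] by (simp add: card_image[OF inj])
qed

lemma const_coeff_comb: "const_coeff (comb r f Y l) = (\<Sum>k<r. const_coeff (f k) * const_coeff (Y k l))"
  for f :: "nat \<Rightarrow> ('v::finite, 'k::comm_ring_1) mpoly"
  by (simp add: comb_def const_coeff_sum const_coeff_mult)

text \<open>An endomorphism of a minimal resolution that lifts zero is null-homotopic, hence zero modulo
  the irrelevant ideal.\<close>

lemma null_endomorphism:
  assumes C: "graded_resolution J C \<Phi>" and J: "graded_ideal J" and min: "minimal_cols C \<Phi>"
    and g: "\<And>i k. k < length (C i) \<Longrightarrow> g i k \<in> vecs (length (C i))"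
    and g0: "\<And>k. k < length (C 0) \<Longrightarrow> g 0 k = 0"
    and chain: "\<And>i k. k < length (C (Suc i)) \<Longrightarrow>
      comb (length (C (Suc i))) (g (Suc i) k) (\<Phi> i) - comb (length (C i)) (\<Phi> i k) (g i) \<in> relations J i"
    and k: "k < length (C (Suc i))"
  shows "const_coeff (g (Suc i) k l) = 0"
proof -
  let ?n = "\<lambda>i. length (C i)"
  \<comment> \<open>\<open>h\<close> is the homotopy from position \<open>i\<close> to
    \<open>i + 1\<close>. The last clause makes \<open>g (Suc i)\<close> minus the part through
    \<open>h\<close> a cycle, so exactness supplies the next homotopy. At \<open>i = 0\<close> it
    must be zero: \<open>\<Phi> 0\<close> may have unit entries, and there two consecutive maps
    compose to zero only modulo \<open>J\<close>.\<close>
  define P where "P i h \<longleftrightarrow> (\<forall>k<?n i. h k \<in> vecs (?n (Suc i))) \<and> (i = 0 \<longrightarrow> h = 0) \<and>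
      (\<forall>k<?n (Suc i). comb (?n (Suc i)) (g (Suc i) k - comb (?n i) (\<Phi> i k) h) (\<Phi> i) \<in> relations J i)" for i h
  have split: "\<exists>y\<in>vecs (?n (Suc (Suc i))).
      g (Suc i) k - comb (?n i) (\<Phi> i k) h = comb (?n (Suc (Suc i))) y (\<Phi> (Suc i))"
    if "P i h" "k < ?n (Suc i)" for i h k
  proof (rule graded_resolution_exact[OF C])
    show "g (Suc i) k - comb (?n i) (\<Phi> i k) h \<in> vecs (?n (Suc i))"
      using that by (intro vecs_diff g comb_in_vecs) (auto simp: P_def)
  qed (use that in \<open>auto simp: P_def\<close>)
  have "\<exists>h. P i h" for i
  proof (induction i)
    case 0
    have "comb (?n 0) (\<Phi> 0 k) (g 0) = 0" for k
      using comb_cong[of "?n 0" "g 0" 0] g0 by simp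
    hence "P 0 0"
      using chain[of _ 0] by (auto simp: P_def)
    thus ?case by blast
  next
    case (Suc i)
    then obtain h where h: "P i h" by blast
    then obtain h' where h': "\<And>k. k < ?n (Suc i) \<Longrightarrow> h' k \<in> vecs (?n (Suc (Suc i)))"
      "\<And>k. k < ?n (Suc i) \<Longrightarrow>
        g (Suc i) k - comb (?n i) (\<Phi> i k) h = comb (?n (Suc (Suc i))) (h' k) (\<Phi> (Suc i))"
      using split by metis
    have "comb (?n (Suc (Suc i))) (g (Suc (Suc i)) k - comb (?n (Suc i)) (\<Phi> (Suc i) k) h') (\<Phi> (Suc i)) = 0"
      if k: "k < ?n (Suc (Suc i))" for k
    proof -
      have "comb (?n (Suc (Suc i))) (comb (?n (Suc i)) (\<Phi> (Suc i) k) h') (\<Phi> (Suc i)) =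
          comb (?n (Suc i)) (\<Phi> (Suc i) k) (\<lambda>j. g (Suc i) j - comb (?n i) (\<Phi> i j) h)"
        unfolding comb_comb by (intro comb_cong) (simp add: h')
      also have "\<dots> = comb (?n (Suc i)) (\<Phi> (Suc i) k) (g (Suc i))
          - comb (?n i) (comb (?n (Suc i)) (\<Phi> (Suc i) k) (\<Phi> i)) h"
        by (simp add: comb_diff_right comb_comb)
      also have "comb (?n i) (comb (?n (Suc i)) (\<Phi> (Suc i) k) (\<Phi> i)) h = 0"
      proof (cases "i = 0")
        case True
        thus ?thesis using h by (simp add: P_def)
      next
        case False
        hence "comb (?n (Suc i)) (\<Phi> (Suc i) k) (\<Phi> i) = 0"
          using graded_resolution_complex_col[OF C k] by (simp add: relations_def)
        thus ?thesis by simp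
      qed
      finally show ?thesis
        using chain[OF k] by (simp add: comb_diff)
    qed
    hence "P (Suc i) h'" using h' by (simp add: P_def)
    thus ?case by blast
  qed
  then obtain h where h: "P i h" by blast
  from split[OF h k] obtain y where
    y: "g (Suc i) k - comb (?n i) (\<Phi> i k) h = comb (?n (Suc (Suc i))) y (\<Phi> (Suc i))" by blast
  have "g (Suc i) k l = comb (?n (Suc (Suc i))) y (\<Phi> (Suc i)) l + comb (?n i) (\<Phi> i k) h l"
    using fun_cong[OF y, of l] by (simp add: algebra_simps)
  moreover have "const_coeff (comb (?n (Suc (Suc i))) y (\<Phi> (Suc i)) l) = 0"
    using min by (simp add: const_coeff_comb minimal_cols_def)
  moreover have "const_coeff (comb (?n i) (\<Phi> i k) h l) = 0"
  proof (cases i)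
    case 0
    thus ?thesis using h by (simp add: P_def)
  next
    case (Suc n)
    have "const_coeff (\<Phi> i k j) = 0" for j
      using min k Suc by (simp add: minimal_cols_def)
    thus ?thesis by (simp add: const_coeff_comb)
  qed
  ultimately show ?thesis by (simp add: const_coeff_add)
qed

lemma count_list_eq_card: "count_list xs x = card {k. k < length xs \<and> xs ! k = x}"
  by (simp add: count_list_eq_length_filter length_filter_conv_card eq_commute)

text \<open>Lift the identity of R/J in both directions. The composite on \<open>C\<close> differs
  from the identity by a lift of zero, hence not at all modulo the irrelevant ideal, so the constant
  terms of the two lifts form a one-sided inverse. Only \<open>C\<close> has to be minimal.\<close>

lemma minimal_resolution_count_le:
  fixes J :: "('v::finite, 'k::field) mpoly set"
  assumes C: "graded_resolution J C \<Phi>" and min: "minimal_cols C \<Phi>" and S: "graded_resolution J S \<Psi>" and J: "graded_ideal J"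
  shows "count_list (C (Suc i)) d \<le> count_list (S (Suc i)) d"
proof -
  let ?n = "\<lambda>i. length (C i)" and ?m = "\<lambda>i. length (S i)"
  have hom1: "(1 :: ('v, 'k) mpoly) \<in> homogeneous 0" by simp
  obtain A where A0: "A 0 = (\<lambda>k l. if k = 0 \<and> l = 0 then 1 else 0)"
    and A1: "\<And>i k. k < ?n i \<Longrightarrow> A i k \<in> free_grading (S i) (C i ! k + 0)"
    and A2: "\<And>i f. f \<in> relations J i \<Longrightarrow> comb (?n i) f (A i) \<in> relations J i"
    and A3: "\<And>i k. k < ?n (Suc i) \<Longrightarrow>
      comb (?m (Suc i)) (A (Suc i) k) (\<Psi> i) - comb (?n i) (\<Phi> i k) (A i) \<in> relations J i"
    using chain_lift[OF C S J J hom1] by auto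
  obtain B where B0: "B 0 = (\<lambda>k l. if k = 0 \<and> l = 0 then 1 else 0)"
    and B1: "\<And>i k. k < ?m i \<Longrightarrow> B i k \<in> free_grading (C i) (S i ! k + 0)"
    and B2: "\<And>i f. f \<in> relations J i \<Longrightarrow> comb (?m i) f (B i) \<in> relations J i"
    and B3: "\<And>i k. k < ?m (Suc i) \<Longrightarrow>
      comb (?n (Suc i)) (B (Suc i) k) (\<Phi> i) - comb (?m i) (\<Psi> i k) (B i) \<in> relations J i"
    using chain_lift[OF S C J J hom1] by auto
  \<comment> \<open>The composite minus the identity: an endomorphism of \<open>C\<close> that lifts
    zero.\<close>
  define g where "g i = (\<lambda>k. comb (?m i) (A i k) (B i) - unit_vec k)" for i
  have null: "const_coeff (g (Suc i) k l) = 0" if "k < ?n (Suc i)" for i k l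
  proof (rule null_endomorphism[OF C J min _ _ _ that])
    show "g i k \<in> vecs (?n i)" if "k < ?n i" for i k
      unfolding g_def using that B1
      by (intro vecs_diff unit_vec_in_vecs comb_in_vecs) (auto simp: free_grading_iff)
    show "g 0 k = 0" if "k < ?n 0" for k
      using that by (auto simp: g_def graded_resolution_0[OF C] graded_resolution_0[OF S] A0 B0 comb_def unit_vec_def fun_eq_iff)
    fix i k assume k: "k < ?n (Suc i)"
    have "comb (?n (Suc i)) (g (Suc i) k) (\<Phi> i) - comb (?n i) (\<Phi> i k) (g i) =
        comb (?m (Suc i)) (A (Suc i) k) (\<lambda>j. comb (?n (Suc i)) (B (Suc i) j) (\<Phi> i) - comb (?m i) (\<Psi> i j) (B i))
        + comb (?m i) (comb (?m (Suc i)) (A (Suc i) k) (\<Psi> i) - comb (?n i) (\<Phi> i k) (A i)) (B i)"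
      using k graded_resolution_vecs[OF C k]
      by (simp add: g_def comb_diff comb_diff_right comb_comb fun_eq_iff)
    also have "\<dots> \<in> relations J i"
      by (intro relations_add[OF J] relations_comb[OF J] B3 B2 A3 k)
    finally show "comb (?n (Suc i)) (g (Suc i) k) (\<Phi> i) - comb (?n i) (\<Phi> i k) (g i) \<in> relations J i" .
  qed
  let ?K = "{k. k < ?n (Suc i) \<and> C (Suc i) ! k = d}" and ?L = "{l. l < ?m (Suc i) \<and> S (Suc i) ! l = d}"
  have "card ?K \<le> card ?L"
  proof (rule card_le_of_right_inverse)
    fix k k' assume k: "k \<in> ?K" and k': "k' \<in> ?K"
    \<comment> \<open>An entry between generators of different degrees is homogeneous of nonzero
      degree, so the constant terms form blocks by degree and the sum may be restricted to degree
      \<open>d\<close>.\<close>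
    have "const_coeff (A (Suc i) k l) = 0" if "l < ?m (Suc i)" "S (Suc i) ! l \<noteq> d" for l
      using A1[of k "Suc i"] k that
      by (intro const_coeff_homogeneous[of _ "d - S (Suc i) ! l"]) (auto simp: free_grading_iff)
    hence "(\<Sum>l\<in>?L. const_coeff (A (Suc i) k l) * const_coeff (B (Suc i) l k')) =
        (\<Sum>l<?m (Suc i). const_coeff (A (Suc i) k l) * const_coeff (B (Suc i) l k'))"
      by (intro sum.mono_neutral_left) auto
    also have "\<dots> = const_coeff (comb (?m (Suc i)) (A (Suc i) k) (B (Suc i)) k')"
      by (simp add: const_coeff_comb)
    also have "\<dots> = const_coeff (unit_vec k k' :: ('v, 'k) mpoly)"
      using null[of k i k'] k by (simp add: g_def const_coeff_diff)
    also have "\<dots> = (if k = k' then 1 else 0)"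
      by (auto simp: unit_vec_def)
    finally show "(\<Sum>l\<in>?L. const_coeff (A (Suc i) k l) * const_coeff (B (Suc i) l k')) = (if k = k' then 1 else 0)" .
  qed simp_all
  thus ?thesis by (simp add: count_list_eq_card)
qed

section \<open>Mapping cones\<close>

definition smul :: "'a::comm_ring_1 \<Rightarrow> (nat \<Rightarrow> 'a) \<Rightarrow> nat \<Rightarrow> 'a" where
  "smul a f = (\<lambda>l. a * f l)"

text \<open>Used on two levels: for elements of a direct sum, and, with vectors as values, for
  stacking the rows of two matrices. Thus \<open>comb_cat\<close> and \<open>comb_cat_right\<close>
  together are multiplication by a block matrix.\<close>

definition cat :: "nat \<Rightarrow> (nat \<Rightarrow> 'a) \<Rightarrow> (nat \<Rightarrow> 'a) \<Rightarrow> nat \<Rightarrow> 'a" where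
  "cat r f g = (\<lambda>k. if k < r then f k else g (k - r))"

lemma comb_smul: "comb r (smul a f) Y = smul a (comb r f Y)"
  by (simp add: smul_def comb_scale)

lemma comb_smul_right: "comb r f (\<lambda>k. smul a (Y k)) = smul a (comb r f Y)"
  by (auto simp: smul_def comb_def fun_eq_iff sum_distrib_left mult_ac)

lemma comb_zero_cols [simp]: "comb r f (\<lambda>k. 0) = 0"
  by (auto simp: comb_def fun_eq_iff)

lemma comb_uminus: "comb r (- f) Y = - comb r f Y"
  using comb_diff[of r 0 f Y] by simp

lemma comb_uminus_right: "comb r f (\<lambda>k. - Y k) = - comb r f Y"
  using comb_diff_right[of r f 0 Y] by simp

lemma smul_in_vecs: "f \<in> vecs r \<Longrightarrow> smul a f \<in> vecs r"
  by (simp add: vecs_def smul_def)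

lemma smul_diff: "smul a (f - g) = smul a f - smul a g"
  by (simp add: smul_def fun_eq_iff algebra_simps)

lemma smul_uminus: "smul a (- f) = - smul a f"
  by (simp add: smul_def fun_eq_iff)

lemma smul_in_relations: "graded_ideal J \<Longrightarrow> f \<in> relations J i \<Longrightarrow> smul a f \<in> relations J i"
  by (auto simp: relations_def smul_def vecs_def graded_ideal_def fun_eq_iff split: if_splits)

lemma smul_in_free_grading:
  assumes "a \<in> homogeneous d" "f \<in> free_grading ds j"
  shows "smul a f \<in> free_grading ds (j + d)"
proof -
  have "a * f k \<in> homogeneous (j + d - ds ! k)" if "k < length ds" for k
    using homogeneous_mult[OF assms(1), of "f k" "j - ds ! k"] assms(2) that
    by (simp add: free_grading_iff algebra_simps)
  thus ?thesis using assms(2) by (auto simp: free_grading_iff smul_def vecs_def)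
qed

lemma comb_cat: "comb (r + s) (cat r f g) (cat r Y Z) = comb r f Y + comb s g Z"
proof (induction s)
  case 0
  show ?case by (auto simp: comb_def cat_def fun_eq_iff)
next
  case (Suc s)
  thus ?case by (simp add: comb_def cat_def fun_eq_iff algebra_simps)
qed

lemma comb_cat_right: "comb s f (\<lambda>k. cat r (Y k) (Z k)) = cat r (comb s f Y) (comb s f Z)"
  by (auto simp: comb_def cat_def fun_eq_iff)

lemma cat_add: "cat r f g + cat r f' g' = cat r (f + f') (g + g')"
  by (auto simp: cat_def fun_eq_iff)

lemma cat_0_right: "f \<in> vecs r \<Longrightarrow> cat r f 0 = f"
  by (auto simp: cat_def vecs_def fun_eq_iff not_less)

lemma cat_in_vecs: "g \<in> vecs s \<Longrightarrow> cat r f g \<in> vecs (r + s)"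
  by (auto simp: cat_def vecs_def)

lemma cat_eq_iff:
  assumes "f \<in> vecs r" "f' \<in> vecs r"
  shows "cat r f g = cat r f' g' \<longleftrightarrow> f = f' \<and> g = g'"
proof
  assume eq: "cat r f g = cat r f' g'"
  have "f k = f' k" for k
    using fun_cong[OF eq, of k] assms by (cases "k < r") (auto simp: cat_def vecs_def)
  moreover have "g k = g' k" for k
    using fun_cong[OF eq, of "r + k"] by (auto simp: cat_def)
  ultimately show "f = f' \<and> g = g'" by auto
qed simp

lemma cat_eq_0_iff: "f \<in> vecs r \<Longrightarrow> cat r f g = 0 \<longleftrightarrow> f = 0 \<and> g = 0"
  using cat_eq_iff[of f r 0 g 0] by (simp add: cat_0_right)

lemma vecs_add_cases:
  fixes h :: "nat \<Rightarrow> 'a::comm_ring_1"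
  assumes "h \<in> vecs (r + s)"
  obtains f g where "f \<in> vecs r" "g \<in> vecs s" "h = cat r f g"
proof (rule that)
  show "(\<lambda>k. if k < r then h k else 0) \<in> vecs r" "(\<lambda>k. h (r + k)) \<in> vecs s"
    using assms by (auto simp: vecs_def)
  show "h = cat r (\<lambda>k. if k < r then h k else 0) (\<lambda>k. h (r + k))"
    by (auto simp: cat_def fun_eq_iff)
qed

lemma cat_in_free_grading:
  assumes "f \<in> free_grading ds j" "g \<in> free_grading es (j - e)"
  shows "cat (length ds) f g \<in> free_grading (ds @ map (\<lambda>x. x + e) es) j"
  using assms by (auto simp: free_grading_iff cat_def vecs_def nth_append algebra_simps)

text \<open>Step n of the cone is step n of \<open>C\<close> plus step n - 1 of \<open>S\<close>
  shifted by \<open>e\<close>. As position 0 is the augmentation, \<open>S\<close> enters only at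
  position 2, through \<open>S 1\<close>; \<open>S 0\<close> does not occur.\<close>

definition cone_deg :: "(nat \<Rightarrow> int list) \<Rightarrow> (nat \<Rightarrow> int list) \<Rightarrow> int \<Rightarrow> nat \<Rightarrow> int list" where
  "cone_deg C S e i = C i @ (case i of Suc (Suc n) \<Rightarrow> map (\<lambda>d. d + e) (S (Suc n)) | _ \<Rightarrow> [])"

lemma cone_deg_simps [simp]:
  "cone_deg C S e 0 = C 0"
  "cone_deg C S e (Suc 0) = C (Suc 0)"
  "cone_deg C S e (Suc (Suc n)) = C (Suc (Suc n)) @ map (\<lambda>d. d + e) (S (Suc n))"
  by (simp_all add: cone_deg_def)

text \<open>The comparison map is \<open>u\<close> times a lift of multiplication by \<open>m\<close>, so that a cone of minimal
  resolutions is minimal as soon as \<open>u\<close> has no constant term.\<close>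

lemma mapping_cone:
  fixes J K I :: "('v::finite, 'k::comm_ring_1) mpoly set"
  assumes C: "graded_resolution J C \<Phi>" and S: "graded_resolution K S \<Psi>" and J: "graded_ideal J" and K: "graded_ideal K"
    and m: "m \<in> homogeneous e" and u: "u \<in> homogeneous d"
    and KJ: "\<And>p. p \<in> K \<Longrightarrow> p * m \<in> J" and JK: "\<And>p. p * m * u \<in> J \<Longrightarrow> p \<in> K"
    and I: "\<And>p. p \<in> I \<longleftrightarrow> (\<exists>r. p - r * m * u \<in> J)"
  obtains \<Theta> where "graded_resolution I (cone_deg C S (e + d)) \<Theta>"
    and "minimal_cols C \<Phi> \<Longrightarrow> minimal_cols S \<Psi> \<Longrightarrow> const_coeff u = 0 \<Longrightarrow> minimal_cols (cone_deg C S (e + d)) \<Theta>"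
proof -
  let ?n = "\<lambda>i. length (C i)" and ?s = "\<lambda>i. length (S i)" and ?D = "cone_deg C S (e + d)"
  \<comment> \<open>The hypotheses say that K = J : m = J : (m u). Lifting needs the inclusion for
    \<open>m\<close> alone; the converse with \<open>m * u\<close> makes multiplication by
    \<open>m * u\<close> injective from R/K to R/J.\<close>
  obtain A where A0: "A 0 = (\<lambda>k l. if k = 0 \<and> l = 0 then m else 0)"
    and A1: "\<And>i k. k < ?s i \<Longrightarrow> A i k \<in> free_grading (C i) (S i ! k + e)"
    and A2: "\<And>i f. f \<in> relations K i \<Longrightarrow> comb (?s i) f (A i) \<in> relations J i"
    and A3: "\<And>i k. k < ?s (Suc i) \<Longrightarrow>
      comb (?n (Suc i)) (A (Suc i) k) (\<Phi> i) - comb (?s i) (\<Psi> i k) (A i) \<in> relations J i"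
    using chain_lift[OF S C K J m KJ] by auto
  have A_vecs: "comb (?s i) g (A i) \<in> vecs (?n i)" for i g
    using A1 by (intro comb_in_vecs) (auto simp: free_grading_iff)
  have \<Phi>_vecs: "comb (?n (Suc i)) f (\<Phi> i) \<in> vecs (?n i)" for i f
    by (intro comb_in_vecs graded_resolution_vecs[OF C])
  have chain: "comb (?n (Suc i)) (comb (?s (Suc i)) g (A (Suc i))) (\<Phi> i)
      - comb (?s i) (comb (?s (Suc i)) g (\<Psi> i)) (A i) \<in> relations J i" for i g
    unfolding comb_comb comb_diff_right[symmetric] by (intro relations_comb J A3)
  have u_chain: "comb (?n (Suc i)) (smul u (comb (?s (Suc i)) g (A (Suc i)))) (\<Phi> i)
      - smul u (comb (?s i) (comb (?s (Suc i)) g (\<Psi> i)) (A i)) \<in> relations J i" for i g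
    using smul_in_relations[OF J chain] by (simp add: comb_smul smul_diff)
  have comb_A0: "comb (?s 0) f (A 0) = (\<lambda>l. if l = 0 then f 0 * m else 0)" for f
    by (auto simp: graded_resolution_0[OF S] A0 comb_def fun_eq_iff)
  \<comment> \<open>Block differential with rows (\<open>\<Phi>\<close>, 0) and (\<open>u\<close>
    times \<open>A\<close>, minus \<open>\<Psi>\<close>). The \<open>\<Psi>\<close> block is absent
    for \<open>i \<le> 1\<close>, because its target would be \<open>S 0\<close> or nothing at
    all.\<close>
  define \<Theta> where "\<Theta> i = cat (?n (Suc i)) (\<lambda>k. cat (?n i) (\<Phi> i k) 0)
      (\<lambda>k. cat (?n i) (smul u (A i k)) (if i \<le> 1 then 0 else - \<Psi> (i - 1) k))" for i
  have bd0: "comb (?n (Suc 0)) f (\<Theta> 0) = comb (?n (Suc 0)) f (\<Phi> 0)" for f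
    using graded_resolution_vecs[OF C, of _ 0] by (intro comb_cong) (simp add: \<Theta>_def cat_def[of "?n (Suc 0)"] cat_0_right)
  have bd: "comb (length (?D (Suc (Suc i)))) (cat (?n (Suc (Suc i))) f g) (\<Theta> (Suc i)) =
      cat (?n (Suc i)) (comb (?n (Suc (Suc i))) f (\<Phi> (Suc i)) + smul u (comb (?s (Suc i)) g (A (Suc i))))
        (if i = 0 then 0 else - comb (?s (Suc i)) g (\<Psi> i))" for i f g
  proof -
    have "comb (?s (Suc i)) g (\<lambda>k. if Suc i \<le> 1 then 0 else - \<Psi> (Suc i - 1) k) =
        (if i = 0 then 0 else - comb (?s (Suc i)) g (\<Psi> i))"
      by (auto simp: comb_uminus_right)
    thus ?thesis
      by (simp add: \<Theta>_def comb_cat comb_cat_right comb_smul_right cat_add)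
  qed
  have graded: "\<Theta> i k \<in> free_grading (?D i) (?D (Suc i) ! k)" if k: "k < length (?D (Suc i))" for i k
  proof (cases i)
    case 0
    thus ?thesis using k graded_resolution_graded[OF C, of k 0] graded_resolution_vecs[OF C, of k 0]
      by (simp add: \<Theta>_def cat_def[of "?n (Suc 0)"] cat_0_right)
  next
    case (Suc n)
    have *: "cat (?n (Suc n)) f g \<in> free_grading (?D (Suc n)) j"
      if "f \<in> free_grading (C (Suc n)) j" "if n = 0 then g = 0 else g \<in> free_grading (S n) (j - (e + d))" for f g j
      using that cat_in_free_grading[of f "C (Suc n)" j g "S n" "e + d"]
      by (cases n) (auto simp: cat_0_right free_grading_in_vecs)
    show ?thesis
    proof (cases "k < ?n (Suc (Suc n))")
      case True
      have "cat (?n (Suc n)) (\<Phi> (Suc n) k) 0 \<in> free_grading (?D (Suc n)) (C (Suc (Suc n)) ! k)"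
        by (intro * graded_resolution_graded[OF C] True) (simp add: free_grading_iff)
      thus ?thesis using True by (simp add: Suc \<Theta>_def cat_def[of "?n (Suc (Suc n))"] nth_append)
    next
      case False
      define k' where "k' = k - ?n (Suc (Suc n))"
      have k': "k' < ?s (Suc n)" using False k Suc by (auto simp: k'_def)
      have "smul u (A (Suc n) k') \<in> free_grading (C (Suc n)) (S (Suc n) ! k' + (e + d))"
        using smul_in_free_grading[OF u A1[OF k']] by (simp add: add.assoc)
      moreover have "- \<Psi> n k' \<in> free_grading (S n) (S (Suc n) ! k')"
        using graded_resolution_graded[OF S k'] by (auto simp: free_grading_iff vecs_def homogeneous_uminus)
      ultimately have "cat (?n (Suc n)) (smul u (A (Suc n) k')) (if n = 0 then 0 else - \<Psi> n k')
          \<in> free_grading (?D (Suc n)) (S (Suc n) ! k' + (e + d))"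
        by (intro *) simp_all
      moreover have "\<Theta> (Suc n) k = cat (?n (Suc n)) (smul u (A (Suc n) k')) (if n = 0 then 0 else - \<Psi> n k')"
        using False by (simp add: \<Theta>_def cat_def[of "?n (Suc (Suc n))"] k'_def)
      moreover have "?D (Suc (Suc n)) ! k = S (Suc n) ! k' + (e + d)"
        using False k' by (simp add: nth_append k'_def)
      ultimately show ?thesis by (simp only: Suc)
    qed
  qed
  have exact: "comb (length (?D (Suc i))) h (\<Theta> i) \<in> relations I i \<longleftrightarrow>
      (\<exists>g\<in>vecs (length (?D (Suc (Suc i)))). h = comb (length (?D (Suc (Suc i)))) g (\<Theta> (Suc i)))"
    (is "?L \<longleftrightarrow> ?R") if h: "h \<in> vecs (length (?D (Suc i)))" for i h
  proof (cases i)
    case 0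
    have cyc: "?L \<longleftrightarrow> comb (?n (Suc 0)) h (\<Phi> 0) 0 \<in> I"
      using \<Phi>_vecs[of 0 h] 0 by (simp add: bd0 relations_def graded_resolution_0[OF C])
    have img: "comb (length (?D (Suc (Suc 0)))) (cat (?n (Suc (Suc 0))) f g) (\<Theta> (Suc 0)) =
      comb (?n (Suc (Suc 0))) f (\<Phi> (Suc 0)) + smul u (comb (?s (Suc 0)) g (A (Suc 0)))" for f g
      unfolding bd by (simp add: cat_0_right vecs_add \<Phi>_vecs smul_in_vecs A_vecs)
    show ?thesis
    proof
      \<comment> \<open>The image of \<open>h\<close> is r m u modulo J. Lifting r through the
        augmentation of \<open>S\<close> gives the coordinate \<open>g\<close>; what remains of
        \<open>h\<close> after subtracting its contribution is a cycle of \<open>C\<close> modulo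
        \<open>J\<close>.\<close>
      assume ?L
      then obtain r where r: "comb (?n (Suc 0)) h (\<Phi> 0) 0 - r * m * u \<in> J" using cyc I by blast
      define w where "w = (\<lambda>l::nat. if l = 0 then r else 0)"
      obtain g where g: "g \<in> vecs (?s (Suc 0))" "w - comb (?s (Suc 0)) g (\<Psi> 0) \<in> relations K 0"
        using graded_resolution_surj[OF S, of w] by (auto simp: w_def vecs_def)
      define f where "f = h - smul u (comb (?s (Suc 0)) g (A (Suc 0)))"
      have "comb (?n (Suc 0)) f (\<Phi> 0) \<in> relations J 0"
      proof -
        have 1: "smul u (comb (?s 0) (w - comb (?s (Suc 0)) g (\<Psi> 0)) (A 0)) \<in> relations J 0"
          by (intro smul_in_relations J A2 g)
        have 2: "comb (?n (Suc 0)) h (\<Phi> 0) - smul u (comb (?s 0) w (A 0)) \<in> relations J 0"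
          using r \<Phi>_vecs[of 0 h] by (auto simp: relations_def comb_A0 w_def smul_def vecs_def graded_resolution_0[OF C] mult_ac)
        show ?thesis
          using relations_diff[OF J relations_add[OF J 1 2] u_chain[of 0 g]]
          by (simp add: f_def comb_diff smul_diff)
      qed
      moreover have "f \<in> vecs (?n (Suc 0))"
        using h 0 unfolding f_def by (intro vecs_diff smul_in_vecs A_vecs) simp_all
      ultimately obtain f' where f': "f' \<in> vecs (?n (Suc (Suc 0)))"
        "f = comb (?n (Suc (Suc 0))) f' (\<Phi> (Suc 0))"
        using graded_resolution_exact[OF C] by blast
      have "h = comb (length (?D (Suc (Suc 0)))) (cat (?n (Suc (Suc 0))) f' g) (\<Theta> (Suc 0))"
        unfolding img f'(2)[symmetric] by (simp add: f_def)
      moreover have "cat (?n (Suc (Suc 0))) f' g \<in> vecs (length (?D (Suc (Suc 0))))"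
        using cat_in_vecs[OF g(1)] by simp
      ultimately show ?R unfolding 0 by blast
    next
      assume ?R
      then obtain f g where fg: "h = comb (length (?D (Suc (Suc 0)))) (cat (?n (Suc (Suc 0))) f g) (\<Theta> (Suc 0))"
        using vecs_add_cases[of _ "?n (Suc (Suc 0))" "?s (Suc 0)"] unfolding 0
        by (metis cone_deg_simps(3) length_append length_map)
      have "comb (?n (Suc 0)) h (\<Phi> 0) - smul u (comb (?s 0) (comb (?s (Suc 0)) g (\<Psi> 0)) (A 0)) \<in> relations J 0"
        using relations_add[OF J graded_resolution_complex[OF C J] u_chain] unfolding fg img
        by (simp add: comb_add add_diff_eq)
      hence "comb (?n (Suc 0)) h (\<Phi> 0) 0 - comb (?s (Suc 0)) g (\<Psi> 0) 0 * m * u \<in> J"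
        by (simp add: relations_def comb_A0 smul_def mult_ac)
      thus ?L using cyc I by blast
    qed
  next
    case (Suc n)
    from h obtain f g where f: "f \<in> vecs (?n (Suc i))" and g: "g \<in> vecs (?s i)" and hfg: "h = cat (?n (Suc i)) f g"
      using vecs_add_cases[of h "?n (Suc i)" "?s i"] unfolding Suc by auto
    have "comb (?n (Suc i)) f (\<Phi> i) + smul u (comb (?s i) g (A i)) \<in> vecs (?n i)"
      by (intro vecs_add \<Phi>_vecs smul_in_vecs A_vecs)
    hence cyc: "?L \<longleftrightarrow> comb (?n (Suc i)) f (\<Phi> i) + smul u (comb (?s i) g (A i)) = 0 \<and>
        (n = 0 \<or> comb (?s (Suc n)) g (\<Psi> n) = 0)"
      unfolding hfg unfolding Suc bd by (simp add: cat_eq_0_iff)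
    have chain': "comb (?n (Suc i)) (comb (?s (Suc i)) g2 (A (Suc i))) (\<Phi> i) =
        comb (?s i) (comb (?s (Suc i)) g2 (\<Psi> i)) (A i)" for g2
      using chain[of i g2] by (simp add: Suc)
    have img: "h = comb (length (?D (Suc (Suc i)))) (cat (?n (Suc (Suc i))) f2 g2) (\<Theta> (Suc i)) \<longleftrightarrow>
        f = comb (?n (Suc (Suc i))) f2 (\<Phi> (Suc i)) + smul u (comb (?s (Suc i)) g2 (A (Suc i))) \<and>
        g = - comb (?s (Suc i)) g2 (\<Psi> i)" for f2 g2
      unfolding hfg bd using f Suc
      by (subst cat_eq_iff) (auto intro: vecs_add \<Phi>_vecs smul_in_vecs A_vecs)
    show ?thesis
    proof
      assume ?L
      hence 1: "comb (?n (Suc i)) f (\<Phi> i) + smul u (comb (?s i) g (A i)) = 0"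
        and 2: "n = 0 \<or> comb (?s (Suc n)) g (\<Psi> n) = 0" using cyc by auto
      \<comment> \<open>For \<open>n = 0\<close> the cone differential does not see
        \<open>\<Psi> 0\<close>, so the cycle condition says nothing about it directly. It is
        recovered from the first coordinate: the augmented value times m u lies in J, hence the
        value in K.\<close>
      have "comb (?s (Suc n)) g (\<Psi> n) \<in> relations K n"
      proof (cases "n = 0")
        case True
        have "comb (?n (Suc 0)) (smul u (comb (?s (Suc 0)) g (A (Suc 0)))) (\<Phi> 0) \<in> relations J 0"
        proof -
          have "smul u (comb (?s (Suc 0)) g (A (Suc 0))) = - comb (?n (Suc (Suc 0))) f (\<Phi> (Suc 0))"
            using 1 Suc True by (simp add: eq_neg_iff_add_eq_0 add.commute)
          thus ?thesis
            using relations_uminus[OF J graded_resolution_complex[OF C J, of 0 f]] by (simp add: comb_uminus)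
        qed
        hence "smul u (comb (?s 0) (comb (?s (Suc 0)) g (\<Psi> 0)) (A 0)) \<in> relations J 0"
          using relations_diff[OF J _ u_chain[of 0 g]] by fastforce
        hence "comb (?s (Suc 0)) g (\<Psi> 0) 0 * m * u \<in> J"
          by (simp add: relations_def smul_def comb_A0 mult_ac)
        moreover have "comb (?s (Suc 0)) g (\<Psi> 0) \<in> vecs (?s 0)"
          by (intro comb_in_vecs graded_resolution_vecs[OF S])
        ultimately show ?thesis
          using JK True by (simp add: relations_def graded_resolution_0[OF S])
      next
        case False
        thus ?thesis using 2 relations_0[OF K] by simp
      qed
      then obtain g2 where g2: "g2 \<in> vecs (?s (Suc i))" "g = comb (?s (Suc i)) g2 (\<Psi> i)"
        using graded_resolution_exact[OF S, of g n] g Suc by auto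
      have "comb (?n (Suc i)) (f + smul u (comb (?s (Suc i)) g2 (A (Suc i)))) (\<Phi> i) = 0"
        using 1 by (simp add: comb_add comb_smul chain' flip: g2(2))
      moreover have "f + smul u (comb (?s (Suc i)) g2 (A (Suc i))) \<in> vecs (?n (Suc i))"
        by (intro vecs_add f smul_in_vecs A_vecs)
      ultimately obtain f3 where f3: "f + smul u (comb (?s (Suc i)) g2 (A (Suc i))) = comb (?n (Suc (Suc i))) f3 (\<Phi> (Suc i))"
        using graded_resolution_exact[OF C] relations_0[OF J, of i] by metis
      \<comment> \<open>The sign of \<open>g2\<close> undoes the sign of the \<open>\<Psi>\<close>
        block.\<close>
      have "h = comb (length (?D (Suc (Suc i)))) (cat (?n (Suc (Suc i))) f3 (- g2)) (\<Theta> (Suc i))"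
        unfolding img using g2(2) f3[symmetric] by (simp add: comb_uminus smul_uminus)
      moreover have "cat (?n (Suc (Suc i))) f3 (- g2) \<in> vecs (length (?D (Suc (Suc i))))"
        using cat_in_vecs[of "- g2" "?s (Suc i)"] g2(1) by (simp add: vecs_def)
      ultimately show ?R by blast
    next
      assume ?R
      then obtain f2 g2 where "h = comb (length (?D (Suc (Suc i)))) (cat (?n (Suc (Suc i))) f2 g2) (\<Theta> (Suc i))"
        using vecs_add_cases[of _ "?n (Suc (Suc i))" "?s (Suc i)"]
        by (metis cone_deg_simps(3) length_append length_map)
      hence "f = comb (?n (Suc (Suc i))) f2 (\<Phi> (Suc i)) + smul u (comb (?s (Suc i)) g2 (A (Suc i))) \<and>
        g = - comb (?s (Suc i)) g2 (\<Psi> i)" unfolding img .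
      hence fg: "f = comb (?n (Suc (Suc i))) f2 (\<Phi> (Suc i)) + smul u (comb (?s (Suc i)) g2 (A (Suc i)))"
        "g = - comb (?s (Suc i)) g2 (\<Psi> i)" by blast+
      have "comb (?n (Suc i)) (comb (?n (Suc (Suc i))) f2 (\<Phi> (Suc i))) (\<Phi> i) = 0"
        using graded_resolution_complex[OF C J, of i f2] Suc by simp
      moreover have "comb (?s (Suc n)) (comb (?s (Suc i)) g2 (\<Psi> i)) (\<Psi> n) = 0" if "n \<noteq> 0"
        using graded_resolution_complex[OF S K, of n g2] Suc that by (simp add: relations_def)
      ultimately show ?L
        unfolding cyc fg by (auto simp: comb_add comb_smul chain' comb_uminus smul_uminus)
    qed
  qed
  have surj: "\<exists>g\<in>vecs (length (?D (Suc 0))). f - comb (length (?D (Suc 0))) g (\<Theta> 0) \<in> relations I 0"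
    if f: "f \<in> vecs 1" for f
  proof -
    have "f \<in> vecs (Suc 0)" using f by simp
    moreover have "J \<subseteq> I" using I by (metis cancel_comm_monoid_add_class.diff_zero mult_zero_left subsetI)
    ultimately show ?thesis using graded_resolution_surj[OF C, of f] by (auto simp: bd0 relations_def)
  qed
  show ?thesis
  proof (rule that[of \<Theta>])
    show "graded_resolution I ?D \<Theta>"
      unfolding graded_resolution_def using graded exact surj by (auto simp: graded_resolution_0[OF C])
    assume min: "minimal_cols C \<Phi>" "minimal_cols S \<Psi>" and u0: "const_coeff u = 0"
    show "minimal_cols ?D \<Theta>"
      unfolding minimal_cols_def
    proof (intro allI impI)
      fix i k l assume k: "k < length (?D (Suc (Suc i)))"
      show "const_coeff (\<Theta> (Suc i) k l) = 0"
      proof (cases "k < ?n (Suc (Suc i))")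
        case True
        thus ?thesis using min(1) by (simp add: \<Theta>_def cat_def minimal_cols_def)
      next
        \<comment> \<open>The mixed block is a multiple of \<open>u\<close>; the possibly
          non-minimal augmentation \<open>\<Psi> 0\<close> is not a block of the cone.\<close>
        case False
        hence "k - ?n (Suc (Suc i)) < ?s (Suc i)" using k by auto
        thus ?thesis using False min(2) u0
          by (cases i) (simp_all add: \<Theta>_def cat_def minimal_cols_def smul_def const_coeff_mult const_coeff_uminus)
      qed
    qed
  qed
qed

section \<open>Squarefree monomial ideals\<close>

definition sqmon :: "'v::finite set \<Rightarrow> 'v \<Rightarrow>\<^sub>0 nat" where
  "sqmon P = (\<Sum>v\<in>P. Poly_Mapping.single v 1)"

definition mon :: "'v::finite set \<Rightarrow> ('v, 'k::comm_ring_1) mpoly" where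
  "mon P = Poly_Mapping.single (sqmon P) 1"

text \<open>A monomial is divisible by a squarefree one exactly if its support contains that of the
  latter, and a monomial ideal contains a polynomial exactly if it contains its terms. Membership
  thus becomes a statement on supports.\<close>

definition sqfree_ideal :: "'v::finite set set \<Rightarrow> ('v, 'k::comm_ring_1) mpoly set" where
  "sqfree_ideal H = {p. \<forall>u\<in>Poly_Mapping.keys p. \<exists>P\<in>H. P \<subseteq> Poly_Mapping.keys u}"

lemma lookup_sqmon: "Poly_Mapping.lookup (sqmon P) v = (if v \<in> P then 1 else 0)"
  by (simp add: sqmon_def lookup_sum lookup_single when_def)

lemma keys_sqmon [simp]: "Poly_Mapping.keys (sqmon P) = P"
  by (auto simp: in_keys_iff lookup_sqmon split: if_splits)

lemma keys_nat_add: "Poly_Mapping.keys (u + w) = Poly_Mapping.keys u \<union> Poly_Mapping.keys w"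
  for u w :: "'v \<Rightarrow>\<^sub>0 nat"
  by (auto simp: in_keys_iff lookup_add)

lemma sqmon_dvd_iff: "(\<exists>w. u = w + sqmon P) \<longleftrightarrow> P \<subseteq> Poly_Mapping.keys u"
proof
  assume "P \<subseteq> Poly_Mapping.keys u"
  hence "u = (u - sqmon P) + sqmon P"
    by (intro poly_mapping_eqI) (auto simp: lookup_add lookup_minus lookup_sqmon in_keys_iff)
  thus "\<exists>w. u = w + sqmon P" by blast
qed (auto simp: keys_nat_add)

lemma mon_homogeneous: "mon P \<in> homogeneous (int (card P))"
proof -
  have "(\<Sum>v\<in>UNIV. Poly_Mapping.lookup (sqmon P) v) = card P"
    by (simp add: lookup_sqmon sum.If_cases)
  hence "mdeg (sqmon P) = int (card P)" by (simp only: mdeg_def)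
  thus ?thesis unfolding mon_def by (rule homogeneous_single)
qed

lemma mon_Un: "P \<inter> Q = {} \<Longrightarrow> mon P * mon Q = mon (P \<union> Q)"
  by (simp add: mon_def mult_single sqmon_def sum.union_disjoint)

lemma mon_empty [simp]: "mon {} = 1"
  by (simp add: mon_def sqmon_def)

lemma var_eq_mon: "var v = mon {v}"
  by (simp add: var_def mon_def sqmon_def)

lemma prod_list_var: "distinct p \<Longrightarrow> prod_list (map var p) = mon (set p)"
proof (induction p)
  case (Cons x p)
  thus ?case using mon_Un[of "{x}" "set p"] by (simp add: var_eq_mon)
qed simp

lemma const_coeff_mon: "P \<noteq> {} \<Longrightarrow> const_coeff (mon P) = 0"
  by (metis const_coeff_def keys_sqmon keys_zero lookup_single_not_eq mon_def)

text \<open>Translating exponents by \<open>w\<close> is injective, so nothing cancels.\<close>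

lemma keys_mult_single_1:
  fixes p :: "('v::finite, 'k::comm_ring_1) mpoly"
  shows "Poly_Mapping.keys (p * Poly_Mapping.single w 1) = (\<lambda>u. u + w) ` Poly_Mapping.keys p"
proof -
  have "p * Poly_Mapping.single w 1 =
      (\<Sum>u\<in>Poly_Mapping.keys p. Poly_Mapping.single u (Poly_Mapping.lookup p u)) * Poly_Mapping.single w 1"
    by (simp add: mpoly_sum_monomials)
  also have "\<dots> = (\<Sum>u\<in>Poly_Mapping.keys p. Poly_Mapping.single (u + w) (Poly_Mapping.lookup p u))"
    by (simp add: sum_distrib_right mult_single)
  finally have eq: "p * Poly_Mapping.single w 1 = \<dots>" .
  have "Poly_Mapping.lookup (p * Poly_Mapping.single w 1) (u + w) = Poly_Mapping.lookup p u" for u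
    unfolding eq by (auto simp: lookup_sum lookup_single when_def in_keys_iff)
  hence "(\<lambda>u. u + w) ` Poly_Mapping.keys p \<subseteq> Poly_Mapping.keys (p * Poly_Mapping.single w 1)"
    by (auto simp: in_keys_iff)
  moreover have "Poly_Mapping.keys (p * Poly_Mapping.single w 1) \<subseteq> (\<lambda>u. u + w) ` Poly_Mapping.keys p"
    using keys_mult[of p "Poly_Mapping.single w 1"] by auto
  ultimately show ?thesis by blast
qed

lemma sqfree_ideal_add: "p \<in> sqfree_ideal H \<Longrightarrow> q \<in> sqfree_ideal H \<Longrightarrow> p + q \<in> sqfree_ideal H"
  using Poly_Mapping.keys_add[of p q] by (auto simp: sqfree_ideal_def)

lemma sqfree_ideal_0 [simp]: "0 \<in> sqfree_ideal H"
  by (simp add: sqfree_ideal_def)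

lemma sqfree_ideal_sum: "(\<And>x. x \<in> A \<Longrightarrow> f x \<in> sqfree_ideal H) \<Longrightarrow> sum f A \<in> sqfree_ideal H"
  by (induction A rule: infinite_finite_induct) (auto intro: sqfree_ideal_add)

lemma sqfree_ideal_mult: "p \<in> sqfree_ideal H \<Longrightarrow> q * p \<in> sqfree_ideal H"
  unfolding sqfree_ideal_def
proof (intro CollectI ballI)
  fix u assume p: "p \<in> {p. \<forall>u\<in>Poly_Mapping.keys p. \<exists>P\<in>H. P \<subseteq> Poly_Mapping.keys u}"
    and "u \<in> Poly_Mapping.keys (q * p)"
  then obtain a b where u: "u = a + b" and "b \<in> Poly_Mapping.keys p"
    using keys_mult[of q p] by auto
  then obtain P where "P \<in> H" "P \<subseteq> Poly_Mapping.keys b"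
    using p by auto
  thus "\<exists>P\<in>H. P \<subseteq> Poly_Mapping.keys u"
    unfolding u keys_nat_add by auto
qed

lemma sqfree_ideal_hcomp: "p \<in> sqfree_ideal H \<Longrightarrow> hcomp e p \<in> sqfree_ideal H"
  by (auto simp: sqfree_ideal_def in_keys_iff hcomp.rep_eq split: if_splits)

lemma graded_ideal_sqfree_ideal: "graded_ideal (sqfree_ideal H)"
  by (simp add: graded_ideal_def sqfree_ideal_add sqfree_ideal_mult sqfree_ideal_hcomp)

lemma sqfree_ideal_mono: "H \<subseteq> H' \<Longrightarrow> sqfree_ideal H \<subseteq> sqfree_ideal H'"
  unfolding sqfree_ideal_def by blast

lemma mon_in_sqfree_ideal: "P \<in> H \<Longrightarrow> mon P \<in> sqfree_ideal H"
  by (auto simp: sqfree_ideal_def mon_def)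

lemma sqfree_ideal_empty [simp]: "sqfree_ideal {} = {0}"
  by (auto simp: sqfree_ideal_def)

lemma sqfree_ideal_UNIV: "{} \<in> H \<Longrightarrow> sqfree_ideal H = UNIV"
  by (auto simp: sqfree_ideal_def)

lemma sqfree_ideal_eqI:
  assumes "\<And>P. P \<in> H \<Longrightarrow> \<exists>Q\<in>H'. Q \<subseteq> P" "\<And>P. P \<in> H' \<Longrightarrow> \<exists>Q\<in>H. Q \<subseteq> P"
  shows "sqfree_ideal H = sqfree_ideal H'"
proof -
  have "(\<exists>P\<in>H. P \<subseteq> X) \<longleftrightarrow> (\<exists>P\<in>H'. P \<subseteq> X)" for X
    using assms by (meson order_trans)
  thus ?thesis by (simp add: sqfree_ideal_def)
qed

text \<open>Multiplying by \<open>mon M\<close> adds \<open>M\<close> to each support, and a member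
  fits into the enlarged support iff its part outside \<open>M\<close> fits into the old
  one.\<close>

lemma sqfree_ideal_colon:
  "p * mon M \<in> sqfree_ideal H \<longleftrightarrow> p \<in> sqfree_ideal ((\<lambda>P. P - M) ` H)"
  by (simp add: sqfree_ideal_def mon_def keys_mult_single_1 keys_nat_add Diff_subset_conv Un_commute)

lemma sqfree_ideal_insert:
  fixes p :: "('v::finite, 'k::comm_ring_1) mpoly"
  shows "p \<in> sqfree_ideal (insert M H) \<longleftrightarrow> (\<exists>r. p - r * mon M \<in> sqfree_ideal H)"
proof
  assume p: "p \<in> sqfree_ideal (insert M H)"
  let ?K = "Poly_Mapping.keys p" and ?s = "\<lambda>u. Poly_Mapping.single u (Poly_Mapping.lookup p u)"
  let ?A = "{u\<in>?K. M \<subseteq> Poly_Mapping.keys u}"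
  \<comment> \<open>The terms of \<open>p\<close> divisible by \<open>mon M\<close>, divided by it;
    the remaining terms must already lie in the ideal of \<open>H\<close>.\<close>
  define r where "r = (\<Sum>u\<in>?A. Poly_Mapping.single (u - sqmon M) (Poly_Mapping.lookup p u))"
  have "r * mon M = (\<Sum>u\<in>?A. ?s u)"
    unfolding r_def sum_distrib_right
  proof (rule sum.cong)
    fix u assume "u \<in> ?A"
    then obtain w where "u = w + sqmon M"
      using sqmon_dvd_iff[of u M] by blast
    thus "Poly_Mapping.single (u - sqmon M) (Poly_Mapping.lookup p u) * mon M = ?s u"
      by (simp add: mon_def mult_single)
  qed simp
  moreover have "p = (\<Sum>u\<in>?A. ?s u) + (\<Sum>u\<in>?K - ?A. ?s u)"
    using sum.subset_diff[of ?A ?K ?s] mpoly_sum_monomials[of p] by (simp add: add.commute)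
  ultimately have "p - r * mon M = (\<Sum>u\<in>?K - ?A. ?s u)" by (simp add: algebra_simps)
  also have "\<dots> \<in> sqfree_ideal H"
    using p by (intro sqfree_ideal_sum) (auto simp: sqfree_ideal_def)
  finally show "\<exists>r. p - r * mon M \<in> sqfree_ideal H" by blast
next
  assume "\<exists>r. p - r * mon M \<in> sqfree_ideal H"
  then obtain r where "p - r * mon M \<in> sqfree_ideal H" by blast
  hence "p - r * mon M \<in> sqfree_ideal (insert M H)" using sqfree_ideal_mono[of H "insert M H"] by blast
  moreover have "r * mon M \<in> sqfree_ideal (insert M H)"
    by (intro sqfree_ideal_mult mon_in_sqfree_ideal) simp
  ultimately show "p \<in> sqfree_ideal (insert M H)"
    using sqfree_ideal_add by fastforce
qed

section \<open>Generated ideals of the polynomial ring\<close>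

lemma poly_ring_simps [simp]:
  "carrier poly_ring = UNIV" "monoid.mult poly_ring = (*)" "one poly_ring = 1"
  "zero poly_ring = 0" "add poly_ring = (+)"
  by (simp_all add: poly_ring_def)

lemma cring_poly_ring: "cring (poly_ring :: ('v, 'k::comm_ring_1) mpoly ring)" (is "cring ?R")
proof (rule cringI)
  show "abelian_group ?R"
  proof (rule abelian_groupI)
    fix x :: "('v, 'k) mpoly"
    show "\<exists>y\<in>carrier poly_ring. y \<oplus>\<^bsub>poly_ring\<^esub> x = \<zero>\<^bsub>poly_ring\<^esub>"
      by (intro bexI[of _ "- x"]) simp_all
  qed (simp_all add: algebra_simps)
  show "Group.comm_monoid ?R"
    by (rule Group.comm_monoidI) (simp_all add: algebra_simps)
qed (simp_all add: algebra_simps)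

lemma ring_poly_ring: "ring poly_ring"
  using cring_poly_ring by (rule cring.axioms)

lemma graded_ideal_ideal:
  fixes J :: "('v::finite, 'k::comm_ring_1) mpoly set"
  assumes "graded_ideal J"
  shows "ideal J poly_ring"
proof (rule idealI[OF ring_poly_ring])
  have neg: "- x \<in> J" if "x \<in> J" for x
    using graded_ideal_diff[OF assms, of 0 x] that assms by (simp add: graded_ideal_def)
  have grp: "Group.group (add_monoid (poly_ring :: ('v, 'k) mpoly ring))"
    by (rule abelian_group.a_group[OF ring.is_abelian_group[OF ring_poly_ring]])
  have inv: "inv\<^bsub>add_monoid poly_ring\<^esub> x = - x" for x :: "('v, 'k) mpoly"
    by (rule group.inv_equality[OF grp]) simp_all
  show "subgroup J (add_monoid poly_ring)"
  proof (rule group.subgroupI[OF grp])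
    show "inv\<^bsub>add_monoid poly_ring\<^esub> x \<in> J" if "x \<in> J" for x
      unfolding inv using that by (rule neg)
  qed (use assms in \<open>auto simp: graded_ideal_def\<close>)
qed (use assms in \<open>auto simp: graded_ideal_def mult.commute\<close>)

lemma genideal_mon:
  "genideal poly_ring (mon ` H) = (sqfree_ideal H :: ('v::finite, 'k::comm_ring_1) mpoly set)"
proof
  show "genideal poly_ring (mon ` H) \<subseteq> sqfree_ideal H"
    by (rule ring.genideal_minimal[OF ring_poly_ring graded_ideal_ideal[OF graded_ideal_sqfree_ideal]])
      (auto intro: mon_in_sqfree_ideal)
next
  let ?G = "genideal poly_ring (mon ` H) :: ('v, 'k) mpoly set"
  interpret ideal ?G poly_ring
    by (rule ring.genideal_ideal[OF ring_poly_ring]) simp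
  have gen: "mon P \<in> ?G" if "P \<in> H" for P
    using ring.genideal_self[OF ring_poly_ring, of "mon ` H"] that by auto
  have sum: "sum f A \<in> ?G" if "\<And>x. x \<in> A \<Longrightarrow> f x \<in> ?G" for f :: "('v \<Rightarrow>\<^sub>0 nat) \<Rightarrow> ('v, 'k) mpoly" and A
    using that additive_subgroup.a_closed[OF additive_subgroup_axioms]
      additive_subgroup.zero_closed[OF additive_subgroup_axioms]
    by (induction A rule: infinite_finite_induct) simp_all
  show "sqfree_ideal H \<subseteq> ?G"
  proof
    fix p :: "('v, 'k) mpoly" assume p: "p \<in> sqfree_ideal H"
    have "(\<Sum>u\<in>Poly_Mapping.keys p. Poly_Mapping.single u (Poly_Mapping.lookup p u)) \<in> ?G"
    proof (rule sum)
      fix u assume "u \<in> Poly_Mapping.keys p"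
      with p obtain P where "P \<in> H" "P \<subseteq> Poly_Mapping.keys u"
        unfolding sqfree_ideal_def by blast
      then obtain w where "u = w + sqmon P" using sqmon_dvd_iff[of u P] by blast
      hence "Poly_Mapping.single u (Poly_Mapping.lookup p u) = Poly_Mapping.single w (Poly_Mapping.lookup p u) * mon P"
        by (simp add: mon_def mult_single)
      thus "Poly_Mapping.single u (Poly_Mapping.lookup p u) \<in> ?G"
        using I_l_closed[OF gen[OF \<open>P \<in> H\<close>]] by simp
    qed
    thus "p \<in> ?G" by (simp add: mpoly_sum_monomials)
  qed
qed

lemma irrelevant_ideal_eq: "irrelevant_ideal = {p :: ('v::finite, 'k::comm_ring_1) mpoly. const_coeff p = 0}"
proof -
  have "range var = (mon ` range (\<lambda>v. {v}) :: ('v, 'k) mpoly set)"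
    by (auto simp: var_eq_mon)
  hence "irrelevant_ideal = (sqfree_ideal (range (\<lambda>v. {v})) :: ('v, 'k) mpoly set)"
    by (simp add: irrelevant_ideal_def genideal_mon)
  moreover have "(\<exists>P\<in>range (\<lambda>v. {v}). P \<subseteq> Poly_Mapping.keys u) \<longleftrightarrow> u \<noteq> 0" for u :: "'v \<Rightarrow>\<^sub>0 nat"
    by (simp add: ex_in_conv)
  moreover have "(\<forall>u\<in>Poly_Mapping.keys p. u \<noteq> 0) \<longleftrightarrow> const_coeff p = 0" for p :: "('v, 'k) mpoly"
    unfolding const_coeff_def by (metis in_keys_iff)
  ultimately show ?thesis
    by (simp add: sqfree_ideal_def)
qed

lemma path_ideal_eq:
  fixes E :: "'v::finite set set"
  shows "(path_ideal t E \<rho> :: ('v, 'k::comm_ring_1) mpoly set) = sqfree_ideal {set p |p. directed_path E \<rho> p \<and> length p = t}"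
proof -
  have "{prod_list (map var p) |p. directed_path E \<rho> p \<and> length p = t} =
      (mon ` {set p |p. directed_path E \<rho> p \<and> length p = t} :: ('v, 'k) mpoly set)"
    by (force simp: prod_list_var directed_path_def)
  thus ?thesis by (simp add: path_ideal_def genideal_mon)
qed

section \<open>Betti numbers of cyclic modules\<close>

lemma comb_Suc: "comb (Suc n) f Y = comb n f Y + (\<lambda>l. f n * Y n l)"
  by (auto simp: comb_def fun_eq_iff)

lemma comb_unit_vec_in_vecs: "n \<le> r \<Longrightarrow> comb n f unit_vec \<in> vecs r"
  by (auto simp: comb_def vecs_def unit_vec_def intro!: sum.neutral)

section \<open>Linear maps on free modules as matrices\<close>

lemma free_module_simps [simp]:
  "carrier (free_module r) = vecs r"
  "zero (free_module r) = 0"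
  "add (free_module r) = (+)"
  "smult (free_module r) = (\<lambda>a f k. a * f k)"
  by (simp_all add: free_module_def vecs_def fun_eq_iff zero_fun_def)

lemma module_free_module:
  "Module.module (poly_ring :: ('v, 'k::comm_ring_1) mpoly ring) (free_module r :: (('v, 'k) mpoly, nat \<Rightarrow> ('v, 'k) mpoly) module)"
  (is "Module.module ?R ?F")
proof (rule moduleI)
  show "cring ?R" by (rule cring_poly_ring)
  show "abelian_group ?F"
  proof (rule abelian_groupI)
    fix x assume "x \<in> carrier ?F"
    thus "\<exists>y\<in>carrier ?F. y \<oplus>\<^bsub>?F\<^esub> x = \<zero>\<^bsub>?F\<^esub>"
      by (intro bexI[of _ "- x"]) (auto simp: vecs_def)
  qed (auto simp: vecs_add algebra_simps)
qed (auto simp: vecs_def fun_eq_iff algebra_simps)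

lemma comb_in_linear_maps:
  fixes Y :: "nat \<Rightarrow> nat \<Rightarrow> ('v, 'k::comm_ring_1) mpoly"
  assumes "\<And>k. k < r \<Longrightarrow> Y k \<in> vecs s"
  shows "(\<lambda>f. comb r f Y) \<in> linear_maps poly_ring (free_module r) (free_module s)"
  using assms by (auto simp: linear_maps_def comb_add comb_scale intro!: comb_in_vecs)

lemma linear_maps_free_add:
  "h \<in> linear_maps poly_ring (free_module r) N \<Longrightarrow> x \<in> vecs r \<Longrightarrow> y \<in> vecs r \<Longrightarrow> h (x + y) = h x \<oplus>\<^bsub>N\<^esub> h y"
  by (simp add: linear_maps_def)

lemma linear_maps_free_smult:
  "h \<in> linear_maps poly_ring (free_module r) N \<Longrightarrow> x \<in> vecs r \<Longrightarrow> h (\<lambda>k. a * x k) = a \<odot>\<^bsub>N\<^esub> h x"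
  by (simp add: linear_maps_def)

text \<open>The target operations are kept abstract so that this also covers maps into a quotient.\<close>

lemma linear_map_comb:
  fixes h :: "(nat \<Rightarrow> ('v, 'k::comm_ring_1) mpoly) \<Rightarrow> 'm"
  assumes h: "h \<in> linear_maps poly_ring (free_module r) N"
    and q0: "q 0 = h 0" and q_add: "\<And>x y. q (x + y) = q x \<oplus>\<^bsub>N\<^esub> q y" and q_smult: "\<And>a x. q (\<lambda>l. a * x l) = a \<odot>\<^bsub>N\<^esub> q x"
    and Y: "\<And>k. k < r \<Longrightarrow> q (Y k) = h (unit_vec k)" and f: "f \<in> vecs r"
  shows "h f = q (comb r f Y)"
proof -
  have "h (comb n f unit_vec) = q (comb n f Y)" if "n \<le> r" for n
    using that
  proof (induction n)
    case 0
    thus ?case using q0 by (simp add: comb_def zero_fun_def)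
  next
    case (Suc n)
    have 1: "comb n f unit_vec \<in> vecs r" using Suc.prems by (simp add: comb_unit_vec_in_vecs)
    have 2: "(\<lambda>l. f n * unit_vec n l) \<in> vecs r" "unit_vec n \<in> vecs r"
      using Suc.prems by (auto simp: vecs_def unit_vec_def)
    have "h (comb (Suc n) f unit_vec) = h (comb n f unit_vec) \<oplus>\<^bsub>N\<^esub> (f n \<odot>\<^bsub>N\<^esub> h (unit_vec n))"
      unfolding comb_Suc linear_maps_free_add[OF h 1 2(1)] linear_maps_free_smult[OF h 2(2)] ..
    also have "\<dots> = q (comb (Suc n) f Y)"
      unfolding comb_Suc using Suc by (simp only: q_add q_smult) (simp add: Y)
    finally show ?case .
  qed
  from this[of r] f show ?thesis by simp
qed

lemma linear_map_free_comb:
  fixes h :: "(nat \<Rightarrow> ('v, 'k::comm_ring_1) mpoly) \<Rightarrow> nat \<Rightarrow> ('v, 'k) mpoly"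
  assumes h: "h \<in> linear_maps poly_ring (free_module r) (free_module s)" and f: "f \<in> vecs r"
  shows "h f = comb r f (\<lambda>k. h (unit_vec k))"
proof -
  \<comment> \<open>\<open>linear_maps\<close> asks only for additivity and homogeneity, so the
    value at zero comes from the scalar 0.\<close>
  have "h (\<lambda>k. 0 * 0 k) = (\<lambda>k. 0 * h 0 k)"
    using linear_maps_free_smult[OF h, of 0 0] by simp
  hence "h 0 = 0" by (simp add: zero_fun_def)
  thus ?thesis using linear_map_comb[OF h, of id] f by simp
qed

context
  fixes J :: "('v::finite, 'k::comm_ring_1) mpoly set"
  assumes J: "graded_ideal J"
begin

interpretation ideal J poly_ring
  by (rule graded_ideal_ideal[OF J])

lemma coset_eq_iff: "J +>\<^bsub>poly_ring\<^esub> p = J +>\<^bsub>poly_ring\<^esub> q \<longleftrightarrow> p - q \<in> J"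
proof -
  have coset: "J +>\<^bsub>poly_ring\<^esub> p = (\<lambda>j. j + p) ` J" for p
    by (auto simp: a_r_coset_def r_coset_def)
  show ?thesis
  proof
    assume "J +>\<^bsub>poly_ring\<^esub> p = J +>\<^bsub>poly_ring\<^esub> q"
    moreover have "p \<in> J +>\<^bsub>poly_ring\<^esub> p" using J by (force simp: coset graded_ideal_def)
    ultimately obtain j where "j \<in> J" "p = j + q" unfolding coset by blast
    thus "p - q \<in> J" by simp
  next
    assume pq: "p - q \<in> J"
    have *: "(\<lambda>j. j + p) ` J \<subseteq> (\<lambda>j. j + q) ` J" if "p - q \<in> J" for p q
    proof
      fix x assume "x \<in> (\<lambda>j. j + p) ` J"
      then obtain j where j: "j \<in> J" "x = j + p" by blast
      hence "x = (j + (p - q)) + q" "j + (p - q) \<in> J"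
        using J that by (simp_all add: graded_ideal_def)
      thus "x \<in> (\<lambda>j. j + q) ` J" by blast
    qed
    have "0 - (p - q) \<in> J" using graded_ideal_diff[OF J _ pq, of 0] J by (simp add: graded_ideal_def)
    hence "q - p \<in> J" by simp
    thus "J +>\<^bsub>poly_ring\<^esub> p = J +>\<^bsub>poly_ring\<^esub> q"
      unfolding coset using *[OF pq] * by blast
  qed
qed

lemma quotient_carrier: "carrier (quotient_module J) = range (\<lambda>p. J +>\<^bsub>poly_ring\<^esub> p)"
  by (auto simp: quotient_module_def FactRing_def A_RCOSETS_def RCOSETS_def a_r_coset_def)

lemma quotient_zero: "\<zero>\<^bsub>quotient_module J\<^esub> = J +>\<^bsub>poly_ring\<^esub> 0"
proof -
  have "J +>\<^bsub>poly_ring\<^esub> 0 = J" by (auto simp: a_r_coset_def r_coset_def)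
  thus ?thesis by (simp add: quotient_module_def FactRing_def)
qed

lemma quotient_add:
  "(J +>\<^bsub>poly_ring\<^esub> p) \<oplus>\<^bsub>quotient_module J\<^esub> (J +>\<^bsub>poly_ring\<^esub> q) = J +>\<^bsub>poly_ring\<^esub> (p + q)"
  using a_rcos_sum[of p q] by (simp add: quotient_module_def FactRing_def)

lemma quotient_smult:
  "a \<odot>\<^bsub>quotient_module J\<^esub> (J +>\<^bsub>poly_ring\<^esub> p) = J +>\<^bsub>poly_ring\<^esub> (a * p)"
  using rcoset_mult_add[of a p] by (simp add: quotient_module_def FactRing_def)

text \<open>The augmentation into the quotient is replaced by a map into R, which becomes position
  0; hence the prefixed list \<open>[0]\<close>. Its columns are representatives of the images of
  the generators.\<close>

lemma minimal_graded_free_resolution_columns: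
  assumes M: "minimal_graded_free_resolution (quotient_module J) (quotient_grading J) D \<phi> \<epsilon>"
  shows "\<exists>\<Phi>. graded_resolution J (case_nat [0] D) \<Phi> \<and> minimal_cols (case_nat [0] D) \<Phi>"
proof -
  let ?C = "case_nat [0] D" and ?n = "\<lambda>i. length (D i)"
  have res: "resolution (quotient_module J) (\<lambda>i. free_module (?n i)) \<phi> \<epsilon>"
    and gr0: "\<And>j. \<epsilon> ` free_grading (D 0) j \<subseteq> quotient_grading J j"
    and gr: "\<And>i j. \<phi> i ` free_grading (D (Suc i)) j \<subseteq> free_grading (D i) j"
    and min: "\<And>i f k. f \<in> vecs (?n (Suc i)) \<Longrightarrow> k < ?n i \<Longrightarrow> const_coeff (\<phi> i f k) = 0"
    using M unfolding minimal_graded_free_resolution_def irrelevant_ideal_eq by auto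
  have \<epsilon>: "\<epsilon> \<in> linear_maps poly_ring (free_module (?n 0)) (quotient_module J)"
    and \<phi>: "\<And>i. \<phi> i \<in> linear_maps poly_ring (free_module (?n (Suc i))) (free_module (?n i))"
    and surj: "\<epsilon> ` vecs (?n 0) = range (\<lambda>p. J +>\<^bsub>poly_ring\<^esub> p)"
    and ex0: "\<phi> 0 ` vecs (?n 1) = {f \<in> vecs (?n 0). \<epsilon> f = J +>\<^bsub>poly_ring\<^esub> 0}"
    and ex: "\<And>i. \<phi> (Suc i) ` vecs (?n (Suc (Suc i))) = {f \<in> vecs (?n (Suc i)). \<phi> i f = 0}"
    using res unfolding resolution_def a_kernel_def' by (auto simp: quotient_carrier quotient_zero)
  have unit: "unit_vec k \<in> free_grading ds (ds ! k)" if "k < length ds" for k ds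
    unfolding free_grading_iff using that by (intro conjI unit_vec_in_vecs) (auto simp: unit_vec_def)
  \<comment> \<open>The representatives are chosen homogeneous, as \<open>\<Phi> 0\<close> has to be
    graded; this is possible because the augmentation preserves degrees.\<close>
  have "\<exists>p\<in>homogeneous (D 0 ! k). \<epsilon> (unit_vec k) = J +>\<^bsub>poly_ring\<^esub> p" if "k < ?n 0" for k
    using gr0[of "D 0 ! k"] unit[OF that] by (auto simp: quotient_grading_def)
  then obtain P where P: "\<And>k. k < ?n 0 \<Longrightarrow> P k \<in> homogeneous (D 0 ! k)"
    "\<And>k. k < ?n 0 \<Longrightarrow> \<epsilon> (unit_vec k) = J +>\<^bsub>poly_ring\<^esub> P k" by metis
  define \<Phi> where "\<Phi> i = (case i of 0 \<Rightarrow> \<lambda>k l. if l = 0 then P k else 0 | Suc j \<Rightarrow> \<lambda>k. \<phi> j (unit_vec k))" for i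
  have \<Phi>0: "comb (?n 0) f (\<Phi> 0) \<in> vecs 1" for f
    by (rule comb_in_vecs) (auto simp: \<Phi>_def vecs_def)
  have "\<epsilon> (\<lambda>k. 0 * 0 k) = 0 \<odot>\<^bsub>quotient_module J\<^esub> \<epsilon> 0"
    using linear_maps_free_smult[OF \<epsilon>, of 0 0] by simp
  moreover have "\<epsilon> 0 \<in> range (\<lambda>p. J +>\<^bsub>poly_ring\<^esub> p)"
    unfolding surj[symmetric] by (rule imageI[OF vecs_0])
  ultimately have \<epsilon>0: "\<epsilon> 0 = J +>\<^bsub>poly_ring\<^esub> 0"
    by (auto simp: quotient_smult zero_fun_def)
  have \<epsilon>_comb: "\<epsilon> f = J +>\<^bsub>poly_ring\<^esub> (comb (?n 0) f (\<Phi> 0) 0)" if "f \<in> vecs (?n 0)" for f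
    by (rule linear_map_comb[OF \<epsilon>, of "\<lambda>x. J +>\<^bsub>poly_ring\<^esub> (x 0)"])
      (use that P in \<open>auto simp: \<epsilon>0 quotient_add quotient_smult \<Phi>_def\<close>)
  have \<epsilon>_0_iff: "\<epsilon> f = J +>\<^bsub>poly_ring\<^esub> 0 \<longleftrightarrow> comb (?n 0) f (\<Phi> 0) \<in> relations J 0" if "f \<in> vecs (?n 0)" for f
    using \<epsilon>_comb[OF that] \<Phi>0[of f] by (simp add: relations_def coset_eq_iff)
  have \<phi>_comb: "\<phi> i f = comb (?n (Suc i)) f (\<Phi> (Suc i))" if "f \<in> vecs (?n (Suc i))" for i f
    using linear_map_free_comb[OF \<phi> that] by (simp add: \<Phi>_def)
  have "graded_resolution J ?C \<Phi>"
    unfolding graded_resolution_def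
  proof (intro conjI allI impI ballI)
    fix i k assume k: "k < length (?C (Suc i))"
    show "\<Phi> i k \<in> free_grading (?C i) (?C (Suc i) ! k)"
    proof (cases i)
      case 0
      thus ?thesis using P k by (auto simp: \<Phi>_def free_grading_iff vecs_def)
    next
      case (Suc j)
      thus ?thesis using gr[of j "D (Suc j) ! k"] unit[of k "D (Suc j)"] k by (auto simp: \<Phi>_def)
    qed
  next
    fix f :: "nat \<Rightarrow> ('v, 'k) mpoly" assume f: "f \<in> vecs 1"
    have "J +>\<^bsub>poly_ring\<^esub> f 0 \<in> \<epsilon> ` vecs (?n 0)"
      unfolding surj by (rule rangeI)
    then obtain g where g: "g \<in> vecs (?n 0)" "J +>\<^bsub>poly_ring\<^esub> f 0 = \<epsilon> g"
      by (rule imageE) (rule that)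
    have "f 0 - comb (?n 0) g (\<Phi> 0) 0 \<in> J"
      using g(2) unfolding \<epsilon>_comb[OF g(1)] coset_eq_iff .
    moreover have "f - comb (?n 0) g (\<Phi> 0) \<in> vecs 1" by (intro vecs_diff f \<Phi>0)
    ultimately show "\<exists>g\<in>vecs (length (?C (Suc 0))). f - comb (length (?C (Suc 0))) g (\<Phi> 0) \<in> relations J 0"
      using g(1) by (auto simp: relations_def)
  next
    fix i and f :: "nat \<Rightarrow> ('v, 'k) mpoly" assume f: "f \<in> vecs (length (?C (Suc i)))"
    show "comb (length (?C (Suc i))) f (\<Phi> i) \<in> relations J i \<longleftrightarrow>
        (\<exists>g\<in>vecs (length (?C (Suc (Suc i)))). f = comb (length (?C (Suc (Suc i)))) g (\<Phi> (Suc i)))"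
    proof (cases i)
      case 0
      have "comb (?n 0) f (\<Phi> 0) \<in> relations J 0 \<longleftrightarrow> f \<in> \<phi> 0 ` vecs (?n 1)"
        using f \<epsilon>_0_iff[of f] by (simp only: ex0) (simp add: 0)
      also have "\<dots> \<longleftrightarrow> (\<exists>g\<in>vecs (?n 1). f = comb (?n 1) g (\<Phi> 1))"
        using \<phi>_comb[of _ 0] by auto
      finally show ?thesis by (simp add: 0)
    next
      case (Suc j)
      have "comb (?n (Suc j)) f (\<Phi> (Suc j)) = 0 \<longleftrightarrow> f \<in> \<phi> (Suc j) ` vecs (?n (Suc (Suc j)))"
        using f \<phi>_comb[of f j] by (simp only: ex) (simp add: Suc)
      also have "\<dots> \<longleftrightarrow> (\<exists>g\<in>vecs (?n (Suc (Suc j))). f = comb (?n (Suc (Suc j))) g (\<Phi> (Suc (Suc j))))"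
        using \<phi>_comb[of _ "Suc j"] by auto
      finally show ?thesis by (simp add: Suc)
    qed
  qed simp
  moreover have "minimal_cols ?C \<Phi>"
    unfolding minimal_cols_def
  proof (intro allI impI)
    fix i k l assume k: "k < length (?C (Suc (Suc i)))"
    have "\<phi> i (unit_vec k) \<in> vecs (?n i)"
      using \<phi>[of i] unit_vec_in_vecs[of k "?n (Suc i)"] k by (auto simp: linear_maps_def)
    hence "const_coeff (\<phi> i (unit_vec k) l) = 0"
      using min[OF unit_vec_in_vecs[of k "?n (Suc i)"], of l] k
      by (cases "l < ?n i") (auto simp: vecs_def)
    thus "const_coeff (\<Phi> (Suc i) k l) = 0" by (simp add: \<Phi>_def)
  qed
  ultimately show ?thesis by blast
qed

lemma graded_resolution_minimal_graded_free:
  assumes C: "graded_resolution J C \<Phi>" and min: "minimal_cols C \<Phi>"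
  shows "\<exists>\<phi> \<epsilon>. minimal_graded_free_resolution (quotient_module J) (quotient_grading J) (\<lambda>i. C (Suc i)) \<phi> \<epsilon>"
proof -
  let ?n = "\<lambda>i. length (C i)"
  define \<phi> where "\<phi> i f = comb (?n (Suc (Suc i))) f (\<Phi> (Suc i))" for i f
  define \<epsilon> where "\<epsilon> f = J +>\<^bsub>poly_ring\<^esub> (comb (?n (Suc 0)) f (\<Phi> 0) 0)" for f
  have \<Phi>0: "comb (?n (Suc 0)) f (\<Phi> 0) \<in> vecs 1" for f
    using graded_resolution_vecs[OF C, of _ 0] graded_resolution_0[OF C] by (intro comb_in_vecs) simp
  have \<Phi>_graded: "comb (?n (Suc i)) f (\<Phi> i) \<in> free_grading (C i) j" if "f \<in> free_grading (C (Suc i)) j" for i j f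
    using comb_in_free_grading[OF that, of "\<Phi> i" "C i" 0] graded_resolution_graded[OF C] by simp
  have \<epsilon>_zero: "\<epsilon> f = J +>\<^bsub>poly_ring\<^esub> 0 \<longleftrightarrow> comb (?n (Suc 0)) f (\<Phi> 0) \<in> relations J 0" for f
    using \<Phi>0[of f] by (simp add: \<epsilon>_def relations_def coset_eq_iff)
  have exact: "(comb (?n (Suc i)) f (\<Phi> i) \<in> relations J i) \<longleftrightarrow>
      (\<exists>g\<in>vecs (?n (Suc (Suc i))). f = comb (?n (Suc (Suc i))) g (\<Phi> (Suc i)))" if "f \<in> vecs (?n (Suc i))" for i f
    using C that unfolding graded_resolution_def by blast
  have \<phi>_vecs: "\<phi> i f \<in> vecs (?n (Suc i))" for i f
    unfolding \<phi>_def by (intro comb_in_vecs graded_resolution_vecs[OF C])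
  have img: "\<phi> i ` vecs (?n (Suc (Suc i))) = {f \<in> vecs (?n (Suc i)). comb (?n (Suc i)) f (\<Phi> i) \<in> relations J i}" for i
  proof -
    have "\<phi> i g \<in> vecs (?n (Suc i))" for g by (rule \<phi>_vecs)
    thus ?thesis using exact unfolding \<phi>_def by blast
  qed
  have "resolution (quotient_module J) (\<lambda>i. free_module (?n (Suc i))) \<phi> \<epsilon>"
    unfolding resolution_def a_kernel_def'
  proof (intro conjI allI)
    show "Module.module poly_ring (free_module (?n (Suc i)))" for i
      by (rule module_free_module)
    show "\<epsilon> \<in> linear_maps poly_ring (free_module (?n (Suc 0))) (quotient_module J)"
      by (auto simp: linear_maps_def quotient_carrier \<epsilon>_def quotient_add quotient_smult comb_add comb_scale)
    show "\<phi> i \<in> linear_maps poly_ring (free_module (?n (Suc (Suc i)))) (free_module (?n (Suc i)))" for i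
      using comb_in_linear_maps[of "?n (Suc (Suc i))" "\<Phi> (Suc i)" "?n (Suc i)"] graded_resolution_vecs[OF C]
      by (simp add: \<phi>_def[abs_def])
    show "\<epsilon> ` carrier (free_module (?n (Suc 0))) = carrier (quotient_module J)"
    proof -
      have "J +>\<^bsub>poly_ring\<^esub> p \<in> \<epsilon> ` vecs (?n (Suc 0))" for p
      proof -
        define f where "f = (\<lambda>l::nat. if l = 0 then p else 0)"
        obtain g where "g \<in> vecs (?n (Suc 0))" "f - comb (?n (Suc 0)) g (\<Phi> 0) \<in> relations J 0"
          using graded_resolution_surj[OF C, of f] by (auto simp: f_def vecs_def)
        thus ?thesis by (intro image_eqI[of _ _ g]) (auto simp: \<epsilon>_def coset_eq_iff relations_def f_def)
      qed
      thus ?thesis by (auto simp: quotient_carrier \<epsilon>_def)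
    qed
    show "\<phi> 0 ` carrier (free_module (?n (Suc 1))) =
        {x \<in> carrier (free_module (?n (Suc 0))). \<epsilon> x = \<zero>\<^bsub>quotient_module J\<^esub>}"
      using img[of 0] by (simp add: quotient_zero \<epsilon>_zero)
    show "\<phi> (Suc i) ` carrier (free_module (?n (Suc (Suc (Suc i))))) =
        {x \<in> carrier (free_module (?n (Suc (Suc i)))). \<phi> i x = \<zero>\<^bsub>free_module (?n (Suc i))\<^esub>}" for i
      using img[of "Suc i"] by (simp add: \<phi>_def)
  qed
  moreover have "\<epsilon> ` free_grading (C (Suc 0)) j \<subseteq> quotient_grading J j" for j
    using \<Phi>_graded[of _ 0 j] graded_resolution_0[OF C] by (auto simp: \<epsilon>_def quotient_grading_def free_grading_iff)
  moreover have "\<phi> i ` free_grading (C (Suc (Suc i))) j \<subseteq> free_grading (C (Suc i)) j" for i j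
    using \<Phi>_graded by (auto simp: \<phi>_def)
  moreover have "\<phi> i f k \<in> irrelevant_ideal" for i f k
    using min by (simp add: irrelevant_ideal_eq \<phi>_def const_coeff_comb minimal_cols_def)
  ultimately have "minimal_graded_free_resolution (quotient_module J) (quotient_grading J) (\<lambda>i. C (Suc i)) \<phi> \<epsilon>"
    unfolding minimal_graded_free_resolution_def by simp
  thus ?thesis by blast
qed

end

text \<open>Two minimal resolutions bound each other's generator counts, so the description defining
  \<open>betti\<close> has a unique solution.\<close>

lemma betti_eq:
  fixes J :: "('v::finite, 'k::field) mpoly set"
  assumes J: "graded_ideal J" and C: "graded_resolution J C \<Phi>" and min: "minimal_cols C \<Phi>"
  shows "betti (quotient_module J) (quotient_grading J) i j = count_list (C (Suc i)) j"
  unfolding betti_def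
proof (rule the_equality)
  obtain \<phi> \<epsilon> where
    "minimal_graded_free_resolution (quotient_module J) (quotient_grading J) (\<lambda>i. C (Suc i)) \<phi> \<epsilon>"
    using graded_resolution_minimal_graded_free[OF J C min] by (elim exE)
  thus "\<exists>D \<phi> \<epsilon>. minimal_graded_free_resolution (quotient_module J) (quotient_grading J) D \<phi> \<epsilon> \<and>
      count_list (C (Suc i)) j = count_list (D i) j"
    by (intro exI[of _ "\<lambda>i. C (Suc i)"] exI[of _ \<phi>] exI[of _ \<epsilon>]) simp
next
  fix b assume "\<exists>D \<phi> \<epsilon>. minimal_graded_free_resolution (quotient_module J) (quotient_grading J) D \<phi> \<epsilon> \<and>
      b = count_list (D i) j"
  then obtain D \<phi> \<epsilon> where M: "minimal_graded_free_resolution (quotient_module J) (quotient_grading J) D \<phi> \<epsilon>"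
    and b: "b = count_list (D i) j"
    by (elim exE conjE)
  obtain \<Psi> where D: "graded_resolution J (case_nat [0] D) \<Psi>" "minimal_cols (case_nat [0] D) \<Psi>"
    using minimal_graded_free_resolution_columns[OF J M] by (elim exE conjE) (rule that)
  have "count_list (C (Suc i)) j \<le> count_list (case_nat [0] D (Suc i)) j"
    by (rule minimal_resolution_count_le[OF C min D(1) J])
  moreover have "count_list (case_nat [0] D (Suc i)) j \<le> count_list (C (Suc i)) j"
    by (rule minimal_resolution_count_le[OF D C J])
  ultimately show "b = count_list (C (Suc i)) j" by (simp add: b)
qed

section \<open>Subadditivity for nested families\<close>

text \<open>For a directed path, the vertices of level at most that of \<open>b\<close> form its
  part from the start to \<open>b\<close>, and two such parts with the same end are comparable.
  Mentioning levels instead of edges keeps the property meaningful once vertices have been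
  deleted.\<close>

definition nested :: "('v \<Rightarrow> nat) \<Rightarrow> 'v set set \<Rightarrow> bool" where
  "nested lev H \<longleftrightarrow> (\<forall>P\<in>H. \<forall>Q\<in>H. \<forall>b\<in>P \<inter> Q.
     {v\<in>P. lev v \<le> lev b} \<subseteq> {v\<in>Q. lev v \<le> lev b} \<or> {v\<in>Q. lev v \<le> lev b} \<subseteq> {v\<in>P. lev v \<le> lev b})"

lemma nestedI:
  assumes "\<And>P Q b. P \<in> H \<Longrightarrow> Q \<in> H \<Longrightarrow> b \<in> P \<Longrightarrow> b \<in> Q \<Longrightarrow>
    {v\<in>P. lev v \<le> lev b} \<subseteq> {v\<in>Q. lev v \<le> lev b} \<or> {v\<in>Q. lev v \<le> lev b} \<subseteq> {v\<in>P. lev v \<le> lev b}"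
  shows "nested lev H"
  unfolding nested_def by (intro ballI) (use assms in simp)

lemma nestedD:
  assumes "nested lev H" "P \<in> H" "Q \<in> H" "b \<in> P" "b \<in> Q"
  shows "{v\<in>P. lev v \<le> lev b} \<subseteq> {v\<in>Q. lev v \<le> lev b} \<or> {v\<in>Q. lev v \<le> lev b} \<subseteq> {v\<in>P. lev v \<le> lev b}"
  using assms(1) unfolding nested_def using assms(2-) by simp

text \<open>The ground field occurs only in the type of the ideal and is therefore passed as \<open>T\<close>.\<close>

definition has_res :: "'k::field itself \<Rightarrow> 'v::finite set set \<Rightarrow> (nat \<Rightarrow> int list) \<Rightarrow> bool" where
  "has_res T H C \<longleftrightarrow> (\<exists>\<Phi>. graded_resolution (sqfree_ideal H :: ('v, 'k) mpoly set) C \<Phi> \<and> minimal_cols C \<Phi>)"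

text \<open>The degrees with nonzero Betti number in step \<open>i\<close>; the index
  \<open>Suc i\<close> skips the augmentation. Quantifying over the resolutions avoids a choice, and
  by \<open>shifts_eq\<close> any one of them determines the set.\<close>

definition shifts :: "'k::field itself \<Rightarrow> 'v::finite set set \<Rightarrow> nat \<Rightarrow> int set" where
  "shifts T H i = {j. \<exists>C. has_res T H C \<and> j \<in> set (C (Suc i))}"

lemma set_subset_of_count_list_le:
  assumes "\<And>x. count_list xs x \<le> count_list ys x"
  shows "set xs \<subseteq> set ys"
proof
  fix x assume "x \<in> set xs"
  thus "x \<in> set ys" using assms[of x] count_list_0_iff[of xs x] count_list_0_iff[of ys x] by auto
qed

lemma shifts_eq:
  assumes "has_res T H C"
  shows "shifts T H i = set (C (Suc i))"
proof -
  have "set (D (Suc i)) \<subseteq> set (C (Suc i))" if "has_res T H D" for D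
    using assms that minimal_resolution_count_le[OF _ _ _ graded_ideal_sqfree_ideal]
    unfolding has_res_def by (intro set_subset_of_count_list_le) blast
  thus ?thesis using assms by (auto simp: shifts_def)
qed

lemma has_res_cong:
  fixes T :: "'k::field itself" and H H' :: "'v::finite set set"
  assumes "(sqfree_ideal H :: ('v, 'k) mpoly set) = sqfree_ideal H'"
  shows "has_res T H = has_res T H'"
  by (simp add: has_res_def assms fun_eq_iff)

lemma shifts_cong:
  fixes T :: "'k::field itself" and H H' :: "'v::finite set set"
  assumes "(sqfree_ideal H :: ('v, 'k) mpoly set) = sqfree_ideal H'"
  shows "shifts T H = shifts T H'"
  by (simp add: shifts_def has_res_cong[OF assms] fun_eq_iff)

lemma vecs_zero_eq [simp]: "vecs 0 = {0}"
  by (auto simp: vecs_def fun_eq_iff)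

text \<open>The quotient is zero, so only the augmentation target remains. The case arises from J :
  m when another member lies inside m.\<close>

lemma has_res_unit_ideal:
  fixes T :: "'k::field itself" and H :: "'v::finite set set"
  assumes "{} \<in> H"
  shows "has_res T H (\<lambda>i. if i = 0 then [0] else [])"
proof -
  have "graded_resolution (sqfree_ideal H :: ('v, 'k) mpoly set) (\<lambda>i. if i = 0 then [0] else []) 0"
    using sqfree_ideal_UNIV[OF assms] by (auto simp: graded_resolution_def relations_def)
  thus ?thesis unfolding has_res_def by (intro exI conjI) (simp_all add: minimal_cols_def)
qed

lemma has_res_empty:
  fixes T :: "'k::field itself"
  shows "has_res T ({} :: 'v::finite set set) (\<lambda>i. if i \<le> 1 then [0] else [])"
proof -
  let ?\<Phi> = "\<lambda>i. if i = 0 then unit_vec else (\<lambda>_ _. 0) :: nat \<Rightarrow> nat \<Rightarrow> ('v, 'k) mpoly"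
  have z: "relations {0} 0 = ({0} :: (nat \<Rightarrow> ('v, 'k) mpoly) set)"
    by (auto simp: relations_def vecs_def fun_eq_iff Suc_le_eq) (metis not_gr_zero)
  have "graded_resolution {0} (\<lambda>i. if i \<le> 1 then [0] else []) ?\<Phi>"
    unfolding graded_resolution_def
  proof (intro conjI allI impI ballI)
    fix i and f :: "nat \<Rightarrow> ('v, 'k) mpoly" assume "f \<in> vecs (length (if Suc i \<le> 1 then [0::int] else []))"
    thus "comb (length (if Suc i \<le> 1 then [0::int] else [])) f (?\<Phi> i) \<in> relations {0} i \<longleftrightarrow>
        (\<exists>g\<in>vecs (length (if Suc (Suc i) \<le> 1 then [0::int] else [])).
          f = comb (length (if Suc (Suc i) \<le> 1 then [0::int] else [])) g (?\<Phi> (Suc i)))"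
      by (cases i) (auto simp: z)
  next
    fix f :: "nat \<Rightarrow> ('v, 'k) mpoly" assume "f \<in> vecs 1"
    thus "\<exists>g\<in>vecs (length (if Suc 0 \<le> 1 then [0::int] else [])).
        f - comb (length (if Suc 0 \<le> 1 then [0::int] else [])) g (?\<Phi> 0) \<in> relations {0} 0"
      by (intro bexI[of _ f]) (simp_all add: z)
  qed (auto simp: free_grading_iff unit_vec_def vecs_def split: if_splits)
  thus ?thesis unfolding has_res_def sqfree_ideal_empty
    by (intro exI conjI) (simp_all add: minimal_cols_def)
qed

text \<open>The cone is taken with m/b as the multiplier to be lifted and u the variable of
  \<open>b\<close>. Since \<open>u\<close> has no constant term, it is minimal.\<close>

lemma cone_has_res:
  fixes T :: "'k::field itself" and H :: "'v::finite set set"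
  assumes b: "b \<in> M" "\<And>P. P \<in> H \<Longrightarrow> b \<notin> P"
    and C: "has_res T H C" and S: "has_res T ((\<lambda>P. P - M) ` H) S"
  shows "has_res T (insert M H) (cone_deg C S (int (card M)))"
proof -
  obtain \<Phi> \<Psi> where \<Phi>: "graded_resolution (sqfree_ideal H :: ('v, 'k) mpoly set) C \<Phi>" "minimal_cols C \<Phi>"
    and \<Psi>: "graded_resolution (sqfree_ideal ((\<lambda>P. P - M) ` H) :: ('v, 'k) mpoly set) S \<Psi>" "minimal_cols S \<Psi>"
    using C S unfolding has_res_def by blast
  have M: "mon (M - {b}) * mon {b} = (mon M :: ('v, 'k) mpoly)"
    using b mon_Un[of "M - {b}" "{b}"] by (simp add: insert_absorb)
  \<comment> \<open>Members of \<open>H\<close> do not contain \<open>b\<close>, so deleting it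
    changes nothing: J : (m/b) = J : m.\<close>
  have "(\<lambda>P. P - (M - {b})) ` H = (\<lambda>P. P - M) ` H"
    using b(2) by (intro image_cong) auto
  hence colon: "p * mon (M - {b}) \<in> sqfree_ideal H \<longleftrightarrow> p \<in> sqfree_ideal ((\<lambda>P. P - M) ` H)" for p :: "('v, 'k) mpoly"
    by (simp add: sqfree_ideal_colon)
  have card: "int (card (M - {b})) + int (card {b}) = int (card M)"
    using b(1) card.remove[of M b] by simp
  have KJ: "p * mon (M - {b}) \<in> sqfree_ideal H" if "p \<in> sqfree_ideal ((\<lambda>P. P - M) ` H)" for p :: "('v, 'k) mpoly"
    using that by (simp add: colon)
  have JK: "p \<in> sqfree_ideal ((\<lambda>P. P - M) ` H)" if "p * mon (M - {b}) * mon {b} \<in> sqfree_ideal H" for p :: "('v, 'k) mpoly"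
    using that by (simp only: mult.assoc M sqfree_ideal_colon)
  have I: "p \<in> sqfree_ideal (insert M H) \<longleftrightarrow> (\<exists>r. p - r * mon (M - {b}) * mon {b} \<in> sqfree_ideal H)" for p :: "('v, 'k) mpoly"
    by (simp only: mult.assoc M sqfree_ideal_insert)
  obtain \<Theta> where
    "graded_resolution (sqfree_ideal (insert M H) :: ('v, 'k) mpoly set) (cone_deg C S (int (card (M - {b})) + int (card {b}))) \<Theta>"
    "minimal_cols C \<Phi> \<Longrightarrow> minimal_cols S \<Psi> \<Longrightarrow> const_coeff (mon {b} :: ('v, 'k) mpoly) = 0 \<Longrightarrow>
      minimal_cols (cone_deg C S (int (card (M - {b})) + int (card {b}))) \<Theta>"
    by (rule mapping_cone[OF \<Phi>(1) \<Psi>(1) graded_ideal_sqfree_ideal graded_ideal_sqfree_ideal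
          mon_homogeneous mon_homogeneous KJ JK I])
      (assumption, assumption, erule that, blast)
  thus ?thesis
    unfolding has_res_def card using \<Phi>(2) \<Psi>(2) const_coeff_mon[of "{b}"] by blast
qed

text \<open>The cone with u = 1, which needs no vertex private to \<open>M\<close> but may fail to
  be minimal. A minimal resolution \<open>D\<close> is therefore assumed separately, and the cone
  only bounds its degrees.\<close>

lemma shifts_insert_subset:
  fixes T :: "'k::field itself" and H :: "'v::finite set set"
  assumes C: "has_res T H C" and S: "has_res T ((\<lambda>P. P - M) ` H) S" and D: "has_res T (insert M H) D"
  shows "shifts T (insert M H) i \<subseteq> set (cone_deg C S (int (card M)) (Suc i))"
proof -
  obtain \<Phi> \<Psi> \<Xi> where \<Phi>: "graded_resolution (sqfree_ideal H :: ('v, 'k) mpoly set) C \<Phi>"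
    and \<Psi>: "graded_resolution (sqfree_ideal ((\<lambda>P. P - M) ` H) :: ('v, 'k) mpoly set) S \<Psi>"
    and \<Xi>: "graded_resolution (sqfree_ideal (insert M H) :: ('v, 'k) mpoly set) D \<Xi>" "minimal_cols D \<Xi>"
    using C S D unfolding has_res_def by blast
  obtain \<Theta> where
    "graded_resolution (sqfree_ideal (insert M H) :: ('v, 'k) mpoly set) (cone_deg C S (int (card M) + 0)) \<Theta>"
    by (rule mapping_cone[OF \<Phi> \<Psi> graded_ideal_sqfree_ideal graded_ideal_sqfree_ideal mon_homogeneous
          homogeneous_1, of M "sqfree_ideal (insert M H)"])
      (simp_all add: sqfree_ideal_colon sqfree_ideal_insert)
  hence "set (D (Suc i)) \<subseteq> set (cone_deg C S (int (card M) + 0) (Suc i))"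
    by (intro set_subset_of_count_list_le minimal_resolution_count_le[OF \<Xi> _ graded_ideal_sqfree_ideal])
  thus ?thesis by (simp add: shifts_eq[OF D])
qed

definition peel :: "'v set set \<Rightarrow> 'v \<Rightarrow> 'v set \<Rightarrow> bool" where
  "peel H b m \<longleftrightarrow> m \<in> H \<and> b \<in> m \<and> (\<forall>P\<in>H. b \<in> P \<longrightarrow> m \<subseteq> P)"

lemma peel_ideal:
  assumes "peel H b m"
  shows "sqfree_ideal H = sqfree_ideal (insert m {P\<in>H. b \<notin> P})"
proof (rule sqfree_ideal_eqI)
  show "\<exists>Q\<in>insert m {P \<in> H. b \<notin> P}. Q \<subseteq> P" if "P \<in> H" for P
    using assms that by (cases "b \<in> P") (auto simp: peel_def)
  show "\<exists>Q\<in>H. Q \<subseteq> P" if "P \<in> insert m {P \<in> H. b \<notin> P}" for P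
    using assms that by (auto simp: peel_def)
qed

lemma peel_card: "peel H b m \<Longrightarrow> card {P\<in>H. b \<notin> P} < card (H :: 'v::finite set set)"
  by (rule psubset_card_mono) (auto simp: peel_def)

lemma peel_card_image: "peel H b m \<Longrightarrow> card ((\<lambda>P. P - M) ` {P\<in>H. b \<notin> P}) < card (H :: 'v::finite set set)"
  by (rule le_less_trans[OF card_image_le peel_card]) simp_all

text \<open>The vertex of largest level in the union works: the members containing it form a chain.\<close>

lemma nested_peel:
  fixes H :: "'v::finite set set"
  assumes nested: "nested lev H" and "H \<noteq> {}" "{} \<notin> H"
  shows "\<exists>b m. peel H b m"
proof -
  have "\<Union>H \<noteq> {}" using assms(2,3) by auto
  hence "Max (lev ` \<Union>H) \<in> lev ` \<Union>H" by (intro Max_in) auto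
  then obtain b where b: "b \<in> \<Union>H" "Max (lev ` \<Union>H) = lev b" by auto
  have max: "lev v \<le> lev b" if "v \<in> P" "P \<in> H" for v P
    unfolding b(2)[symmetric] using that by (intro Max_ge) auto
  have chain: "P \<subseteq> Q \<or> Q \<subseteq> P" if "P \<in> H" "Q \<in> H" "b \<in> P" "b \<in> Q" for P Q
  proof -
    have "{v\<in>P. lev v \<le> lev b} = P" "{v\<in>Q. lev v \<le> lev b} = Q"
      using max that by auto
    thus ?thesis using nestedD[OF nested that] by simp
  qed
  obtain m where "m \<in> {P\<in>H. b \<in> P}" "\<forall>P\<in>{P\<in>H. b \<in> P}. P \<subseteq> m \<longrightarrow> m = P"
    using finite_has_minimal[of "{P\<in>H. b \<in> P}"] b(1) by auto
  hence "peel H b m" using chain unfolding peel_def by blast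
  thus ?thesis by blast
qed

lemma nested_subset: "nested lev H \<Longrightarrow> H' \<subseteq> H \<Longrightarrow> nested lev H'"
  by (rule nestedI, rule nestedD[of lev H]) auto

lemma nested_diff:
  assumes "nested lev H"
  shows "nested lev ((\<lambda>P. P - M) ` H)"
proof (rule nestedI)
  fix P Q b assume "P \<in> (\<lambda>P. P - M) ` H" "Q \<in> (\<lambda>P. P - M) ` H" "b \<in> P" "b \<in> Q"
  then obtain P' Q' where "P' \<in> H" "Q' \<in> H" and eq: "P = P' - M" "Q = Q' - M" and "b \<in> P'" "b \<in> Q'" by auto
  hence "{v\<in>P'. lev v \<le> lev b} \<subseteq> {v\<in>Q'. lev v \<le> lev b} \<or> {v\<in>Q'. lev v \<le> lev b} \<subseteq> {v\<in>P'. lev v \<le> lev b}"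
    by (intro nestedD[OF assms])
  thus "{v\<in>P. lev v \<le> lev b} \<subseteq> {v\<in>Q. lev v \<le> lev b} \<or> {v\<in>Q. lev v \<le> lev b} \<subseteq> {v\<in>P. lev v \<le> lev b}"
    unfolding eq by auto
qed

text \<open>The cones build the resolution, starting from the zero ideal and the unit ideal.\<close>

lemma nested_has_res:
  fixes T :: "'k::field itself" and H :: "'v::finite set set"
  shows "nested lev H \<Longrightarrow> \<exists>C. has_res T H C"
proof (induction "card H" arbitrary: H rule: less_induct)
  case less
  show ?case
  proof (cases "H = {} \<or> {} \<in> H")
    case True
    thus ?thesis using has_res_empty[of T] has_res_unit_ideal[of H T] by blast
  next
    case False
    then obtain b m where bm: "peel H b m" using nested_peel[OF less.prems] by blast
    let ?H = "{P\<in>H. b \<notin> P}"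
    have nH: "nested lev ?H" by (rule nested_subset[OF less.prems]) auto
    obtain C S where "has_res T ?H C" "has_res T ((\<lambda>P. P - m) ` ?H) S"
      using less.hyps[OF peel_card[OF bm] nH] less.hyps[OF peel_card_image[OF bm] nested_diff[OF nH]] by blast
    hence "has_res T (insert m ?H) (cone_deg C S (int (card m)))"
      using bm by (intro cone_has_res) (auto simp: peel_def)
    hence "has_res T H (cone_deg C S (int (card m)))"
      by (simp only: has_res_cong[OF peel_ideal[OF bm]])
    thus ?thesis by blast
  qed
qed

lemma set_cone_deg:
  "set (cone_deg C S e (Suc i)) = set (C (Suc i)) \<union> (case i of 0 \<Rightarrow> {} | Suc n \<Rightarrow> (\<lambda>d. d + e) ` set (S (Suc n)))"
  by (cases i) auto

text \<open>Minimality of the cone gives equality here. Both inclusions are used: one to split a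
  given shift, the other to carry shifts of the smaller families back to \<open>H\<close>.\<close>

lemma shifts_peel:
  fixes T :: "'k::field itself" and H :: "'v::finite set set"
  assumes H: "nested lev H" and bm: "peel H b m"
  defines "H' \<equiv> {P\<in>H. b \<notin> P}"
  shows "shifts T H i = shifts T H' i \<union>
    (case i of 0 \<Rightarrow> {} | Suc n \<Rightarrow> (\<lambda>d. d + int (card m)) ` shifts T ((\<lambda>P. P - m) ` H') n)"
proof -
  have nH: "nested lev H'" unfolding H'_def by (rule nested_subset[OF H]) auto
  obtain C S where C: "has_res T H' C" and S: "has_res T ((\<lambda>P. P - m) ` H') S"
    using nested_has_res[OF nH] nested_has_res[OF nested_diff[OF nH]] by blast
  have cone: "has_res T (insert m H') (cone_deg C S (int (card m)))"
    using bm C S by (intro cone_has_res) (auto simp: peel_def H'_def)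
  have "shifts T H = shifts T (insert m H')"
    unfolding H'_def by (rule shifts_cong[OF peel_ideal[OF bm]])
  thus ?thesis
    by (cases i) (simp_all add: shifts_eq[OF cone] shifts_eq[OF C] shifts_eq[OF S] set_cone_deg)
qed

lemma shifts_insert_subset_nested:
  fixes T :: "'k::field itself" and H :: "'v::finite set set"
  assumes H: "nested lev H" and M: "nested lev (insert M H)"
  shows "shifts T (insert M H) i \<subseteq> shifts T H i \<union>
    (case i of 0 \<Rightarrow> {} | Suc n \<Rightarrow> (\<lambda>d. d + int (card M)) ` shifts T ((\<lambda>P. P - M) ` H) n)"
proof -
  obtain C S D where C: "has_res T H C" and S: "has_res T ((\<lambda>P. P - M) ` H) S"
    and D: "has_res T (insert M H) D"
    using nested_has_res[OF H] nested_has_res[OF nested_diff[OF H]] nested_has_res[OF M] by blast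
  show ?thesis
    using shifts_insert_subset[OF C S D, of i]
    by (cases i) (simp_all add: shifts_eq[OF C] shifts_eq[OF S] set_cone_deg)
qed

lemma shifts_unit_ideal: "{} \<in> H \<Longrightarrow> shifts T H i = {}"
  using shifts_eq[OF has_res_unit_ideal[of H T], of i] by simp

lemma shifts_empty: "shifts T {} i = (if i = 0 then {0} else {})"
  using shifts_eq[OF has_res_empty[of T], of i] by auto

text \<open>Peeling leaves step 0 untouched, so the generator of R persists from the zero ideal on.
  It is the witness for the trivial summand of subadditivity.\<close>

lemma zero_in_shifts:
  fixes T :: "'k::field itself" and H :: "'v::finite set set"
  shows "nested lev H \<Longrightarrow> {} \<notin> H \<Longrightarrow> 0 \<in> shifts T H 0"
proof (induction "card H" arbitrary: H rule: less_induct)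
  case less
  show ?case
  proof (cases "H = {}")
    case True
    thus ?thesis by (simp add: shifts_empty)
  next
    case False
    then obtain b m where bm: "peel H b m" using nested_peel[OF less.prems(1) _ less.prems(2)] by blast
    have "0 \<in> shifts T {P\<in>H. b \<notin> P} 0"
      using less.prems nested_subset[OF less.prems(1), of "{P\<in>H. b \<notin> P}"]
      by (intro less.hyps[OF peel_card[OF bm]]) auto
    thus ?thesis by (simp add: shifts_peel[OF less.prems(1) bm])
  qed
qed

text \<open>Deleting a vertex from all members amounts to setting its variable to \<open>1\<close> in the ideal.\<close>

lemma shifts_remove_vertex:
  fixes T :: "'k::field itself" and H :: "'v::finite set set"
  shows "nested lev H \<Longrightarrow> d \<in> shifts T ((\<lambda>P. P - {x}) ` H) i \<Longrightarrow> \<exists>d'\<in>shifts T H i. d \<le> d'"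
proof (induction "card H" arbitrary: H d i rule: less_induct)
  case less
  let ?X = "(\<lambda>P. P - {x}) ` H"
  have nX: "nested lev ?X" by (rule nested_diff[OF less.prems(1)])
  show ?case
  proof (cases "H = {} \<or> {} \<in> ?X")
    case True
    thus ?thesis using less.prems(2) shifts_unit_ideal[of ?X T] by auto
  next
    case False
    hence "H \<noteq> {}" "{} \<notin> H" by force+
    then obtain b m where bm: "peel H b m" using nested_peel[OF less.prems(1)] by blast
    let ?H = "{P\<in>H. b \<notin> P}"
    have nH: "nested lev ?H" by (rule nested_subset[OF less.prems(1)]) auto
    note peel = shifts_peel[OF less.prems(1) bm, of T]
    show ?thesis
    proof (cases "x = b")
      case False
      \<comment> \<open>Peeling commutes with deleting \<open>x\<close>: \<open>b\<close> is now
        peeled with m - {x}, and the two smaller families are those of \<open>H\<close> with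
        \<open>x\<close> deleted, so the induction hypothesis applies to both.\<close>
      have bX: "peel ?X b (m - {x})"
        using bm False by (auto simp: peel_def)
      have X': "{P\<in>?X. b \<notin> P} = (\<lambda>P. P - {x}) ` ?H"
        using False by auto
      have X'': "(\<lambda>P. P - (m - {x})) ` (\<lambda>P. P - {x}) ` ?H = (\<lambda>P. P - {x}) ` (\<lambda>P. P - m) ` ?H"
        unfolding image_image by (intro image_cong) auto
      from less.prems(2) consider "d \<in> shifts T ((\<lambda>P. P - {x}) ` ?H) i"
        | n d0 where "i = Suc n" "d = d0 + int (card (m - {x}))" "d0 \<in> shifts T ((\<lambda>P. P - {x}) ` (\<lambda>P. P - m) ` ?H) n"
        unfolding shifts_peel[OF nX bX, of T i] X' X'' by (cases i) auto
      thus ?thesis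
      proof cases
        case 1
        thus ?thesis using less.hyps[OF peel_card[OF bm] nH] peel[of i] by blast
      next
        case 2
        obtain d' where "d' \<in> shifts T ((\<lambda>P. P - m) ` ?H) n" "d0 \<le> d'"
          using less.hyps[OF peel_card_image[OF bm] nested_diff[OF nH] 2(3)] by blast
        moreover have "card (m - {x}) \<le> card m" by (rule card_mono) auto
        ultimately show ?thesis
          using 2 by (intro bexI[of _ "d' + int (card m)"]) (auto simp: peel[of "Suc n"])
      qed
    next
      \<comment> \<open>Now \<open>b\<close> occurs in no member of \<open>?X\<close> and cannot be
        peeled there. The members that went through \<open>b\<close> are all multiples of m/b, so
        the ideal is J + (m/b).\<close>
      case True
      have "(sqfree_ideal ?X :: ('v, 'k) mpoly set) = sqfree_ideal (insert (m - {b}) ?H)"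
      proof (rule sqfree_ideal_eqI)
        show "\<exists>Q\<in>insert (m - {b}) ?H. Q \<subseteq> P" if "P \<in> ?X" for P
        proof -
          from that obtain Q where Q: "Q \<in> H" "P = Q - {b}" unfolding True by blast
          show ?thesis
          proof (cases "b \<in> Q")
            case True
            hence "m - {b} \<subseteq> P" using bm Q by (auto simp: peel_def)
            thus ?thesis by blast
          next
            case False
            hence "P \<in> ?H" using Q by simp
            thus ?thesis by blast
          qed
        qed
        show "\<exists>Q\<in>?X. Q \<subseteq> P" if "P \<in> insert (m - {b}) ?H" for P
        proof (cases "P = m - {b}")
          case True
          hence "P \<in> ?X" using bm \<open>x = b\<close> by (auto simp: peel_def)
          thus ?thesis by blast
        next
          case False
          hence "P \<in> H" using that by auto
          thus ?thesis by (intro bexI[of _ "P - {x}"]) auto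
        qed
      qed
      hence X: "shifts T ?X = shifts T (insert (m - {b}) ?H)" by (rule shifts_cong)
      \<comment> \<open>Members avoiding \<open>b\<close> are their own images under deletion, so
        this is a subfamily of \<open>?X\<close> and inherits nestedness.\<close>
      have "insert (m - {b}) ?H \<subseteq> ?X"
        using bm True by (auto simp: peel_def image_iff)
      hence ins: "nested lev (insert (m - {b}) ?H)" by (rule nested_subset[OF nX])
      have colon: "(\<lambda>P. P - (m - {b})) ` ?H = (\<lambda>P. P - m) ` ?H"
        by (intro image_cong) auto
      have "d \<in> shifts T ?H i \<union>
          (case i of 0 \<Rightarrow> {} | Suc n \<Rightarrow> (\<lambda>d. d + int (card (m - {b}))) ` shifts T ((\<lambda>P. P - m) ` ?H) n)"
        using shifts_insert_subset_nested[OF nH ins, of T i] less.prems(2) unfolding X colon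
        by (rule subsetD)
      then consider "d \<in> shifts T ?H i"
        | n d0 where "i = Suc n" "d = d0 + int (card (m - {b}))" "d0 \<in> shifts T ((\<lambda>P. P - m) ` ?H) n"
        by (cases i) auto
      thus ?thesis
      proof cases
        case 1
        thus ?thesis using peel[of i] by blast
      next
        case 2
        have "card (m - {b}) \<le> card m" by (rule card_mono) auto
        thus ?thesis
          using 2 by (intro bexI[of _ "d0 + int (card m)"]) (auto simp: peel[of "Suc n"])
      qed
    qed
  qed
qed

lemma shifts_remove_vertices:
  fixes T :: "'k::field itself" and H :: "'v::finite set set"
  assumes H: "nested lev H" and d: "d \<in> shifts T ((\<lambda>P. P - M) ` H) i"
  shows "\<exists>d'\<in>shifts T H i. d \<le> d'"
proof -
  have "finite M" by simp
  thus ?thesis using d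
  proof (induction M arbitrary: d)
    case empty
    thus ?case by auto
  next
    case (insert x M)
    have "(\<lambda>P. P - insert x M) ` H = (\<lambda>P. P - {x}) ` (\<lambda>P. P - M) ` H"
      unfolding image_image by (intro image_cong) auto
    with insert.prems obtain d1 where "d1 \<in> shifts T ((\<lambda>P. P - M) ` H) i" "d \<le> d1"
      using shifts_remove_vertex[OF nested_diff[OF H]] by metis
    thus ?case using insert.IH by (meson order_trans)
  qed
qed

text \<open>In the cone part of step i + j, the one step and the degree contributed by m are charged
  to the first summand; this is why i has to be positive there.\<close>

lemma shifts_subadditive:
  fixes T :: "'k::field itself" and H :: "'v::finite set set"
  shows "nested lev H \<Longrightarrow> d \<in> shifts T H (i + j) \<Longrightarrow>
    \<exists>d1\<in>shifts T H i. \<exists>d2\<in>shifts T H j. d \<le> d1 + d2"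
proof (induction "card H" arbitrary: H d i j rule: less_induct)
  case less
  show ?case
  proof (cases "{} \<in> H \<or> i = 0")
    case True
    \<comment> \<open>The unit ideal has no shifts, so the assumption on \<open>d\<close> excludes
      it. The witnesses for i = 0 are 0 and \<open>d\<close>.\<close>
    hence "i = 0" "{} \<notin> H" using less.prems(2) shifts_unit_ideal[of H T] by auto
    thus ?thesis using less.prems zero_in_shifts[OF less.prems(1)] by force
  next
    case False
    show ?thesis
    proof (cases "H = {}")
      case True
      thus ?thesis using less.prems(2) False by (simp add: shifts_empty)
    next
      case H: False
      then obtain b m where bm: "peel H b m" using nested_peel[OF less.prems(1) H] False by blast
      let ?H = "{P\<in>H. b \<notin> P}"
      have nH: "nested lev ?H" by (rule nested_subset[OF less.prems(1)]) auto
      note peel = shifts_peel[OF less.prems(1) bm, of T]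
      obtain i' where i: "i = Suc i'" using False by (cases i) auto
      have sub: "shifts T ?H k \<subseteq> shifts T H k" for k using peel[of k] by blast
      from less.prems(2) consider "d \<in> shifts T ?H (i + j)"
        | d0 where "d = d0 + int (card m)" "d0 \<in> shifts T ((\<lambda>P. P - m) ` ?H) (i' + j)"
        unfolding peel by (auto simp: i)
      thus ?thesis
      proof cases
        case 1
        thus ?thesis using less.hyps[OF peel_card[OF bm] nH] sub by blast
      next
        case 2
        obtain d1 d2 where d12: "d1 \<in> shifts T ((\<lambda>P. P - m) ` ?H) i'" "d2 \<in> shifts T ((\<lambda>P. P - m) ` ?H) j" "d0 \<le> d1 + d2"
          using less.hyps[OF peel_card_image[OF bm] nested_diff[OF nH] 2(2)] by blast
        \<comment> \<open>\<open>d2\<close> is a shift of J : m. Deleting the vertices of m does not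
          raise maximal shifts, and all shifts of J persist in \<open>H\<close>.\<close>
        obtain d2' where "d2' \<in> shifts T H j" "d2 \<le> d2'"
          using shifts_remove_vertices[OF nH d12(2)] sub by blast
        moreover have "d1 + int (card m) \<in> shifts T H i"
          using d12(1) by (simp add: peel i)
        ultimately show ?thesis
          using 2(1) d12(3) by (intro bexI[of _ "d1 + int (card m)"] bexI[of _ d2']) auto
      qed
    qed
  qed
qed

text \<open>The inequality of suprema follows elementwise, which also covers an empty set of shifts
  on the left, where the supremum is minus infinity.\<close>

lemma subadditivity_sqfree_ideal:
  fixes H :: "'v::finite set set"
  assumes H: "nested lev H"
  shows "subadditivity_holds (quotient_module (sqfree_ideal H :: ('v, 'k::field) mpoly set))
    (quotient_grading (sqfree_ideal H :: ('v, 'k) mpoly set))"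
proof -
  let ?J = "sqfree_ideal H :: ('v, 'k) mpoly set" and ?S = "shifts TYPE('k) H"
  obtain C where C: "has_res TYPE('k) H C" using nested_has_res[OF H] by blast
  then obtain \<Phi> where \<Phi>: "graded_resolution ?J C \<Phi>" "minimal_cols C \<Phi>"
    unfolding has_res_def by blast
  have "betti (quotient_module ?J) (quotient_grading ?J) i j = count_list (C (Suc i)) j" for i j
    by (rule betti_eq[OF graded_ideal_sqfree_ideal \<Phi>])
  hence "{j. betti (quotient_module ?J) (quotient_grading ?J) i j \<noteq> 0} = ?S i" for i
    by (auto simp: shifts_eq[OF C] count_list_0_iff)
  hence max: "max_shift (quotient_module ?J) (quotient_grading ?J) i = (SUP j\<in>?S i. ereal (real_of_int j))" for i
    by (simp add: max_shift_def)
  show ?thesis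
    unfolding subadditivity_holds_def max
  proof (intro allI impI SUP_least)
    fix a b d assume "d \<in> ?S (a + b)"
    then obtain d1 d2 where d12: "d1 \<in> ?S a" "d2 \<in> ?S b" "d \<le> d1 + d2"
      using shifts_subadditive[OF H] by blast
    have "ereal (real_of_int d) \<le> ereal (real_of_int d1) + ereal (real_of_int d2)"
      using d12(3) by simp
    also have "\<dots> \<le> (SUP j\<in>?S a. ereal (real_of_int j)) + (SUP j\<in>?S b. ereal (real_of_int j))"
      using d12 by (intro add_mono SUP_upper)
    finally show "ereal (real_of_int d) \<le> (SUP j\<in>?S a. ereal (real_of_int j)) + (SUP j\<in>?S b. ereal (real_of_int j))" .
  qed
qed

section \<open>Directed paths in rooted trees\<close>

lemma successively_rev_edge:
  "successively (\<lambda>x y. {x, y} \<in> E) (rev p) \<longleftrightarrow> successively (\<lambda>x y. {x, y} \<in> E) p"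
  by (simp add: successively_rev insert_commute)

lemma successively_prefix: "successively P (xs @ ys) \<Longrightarrow> successively P xs"
  by (simp add: successively_append_iff)

text \<open>If two paths with the same ends separate right after the start, following one up to its
  first vertex on the other and returning along the other gives a cycle. Otherwise the common first
  vertex is stripped off.\<close>

lemma path_unique:
  assumes acyclic: "\<nexists>c. graph_cycle E c"
    and "path_between E u v p" "path_between E u v q"
  shows "p = q"
  using assms(2,3)
proof (induction p arbitrary: u q)
  case Nil
  thus ?case by (simp add: path_between_def)
next
  case (Cons x p)
  hence p: "x = u" "last (u # p) = v" "distinct (u # p)" "successively (\<lambda>x y. {x, y} \<in> E) (u # p)"
    by (auto simp: path_between_def)
  from Cons.prems(2) obtain q' where qq: "q = u # q'"
    by (cases q) (auto simp: path_between_def)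
  hence q: "last (u # q') = v" "distinct (u # q')" "successively (\<lambda>x y. {x, y} \<in> E) (u # q')"
    using Cons.prems(2) by (auto simp: path_between_def)
  show ?case
  proof (cases "p = [] \<or> q' = []")
    case True
    hence "u = v" using p(2) q(1) by auto
    hence "p = []" "q' = []"
      using p(2,3) q(1,2) last_in_set[of p] last_in_set[of q'] by (auto split: if_splits)
    thus ?thesis using qq p by simp
  next
    case False
    hence ne: "p \<noteq> []" "q' \<noteq> []" by auto
    have "hd p = hd q'"
    proof (rule ccontr)
      assume hd: "hd p \<noteq> hd q'"
      have "v \<in> set p" "v \<in> set q'"
        using p(2) q(1) last_in_set[OF ne(1)] last_in_set[OF ne(2)] ne by simp_all
      hence "\<exists>w\<in>set p. w \<in> set q'" by blast
      from split_list_first_prop[OF this]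
      obtain p1 w p2 where w: "p = p1 @ w # p2" "w \<in> set q'" "\<forall>y\<in>set p1. y \<notin> set q'"
        by blast
      from w(2) obtain q1 q2 where q12: "q' = q1 @ w # q2" by (meson split_list)
      \<comment> \<open>Out along \<open>p\<close> to the first meeting point \<open>w\<close>, back
        along the initial part of \<open>q'\<close>; the closing edge leads to
        \<open>u\<close>.\<close>
      let ?c = "u # p1 @ w # rev q1"
      have s1: "successively (\<lambda>x y. {x, y} \<in> E) ((u # p1) @ [w])"
        using p(4) successively_prefix[of _ "(u # p1) @ [w]" p2] unfolding w(1) by simp
      have "successively (\<lambda>x y. {x, y} \<in> E) (u # q1 @ [w])"
        using q(3) successively_prefix[of _ "u # q1 @ [w]" q2] unfolding q12 by simp
      hence "successively (\<lambda>x y. {x, y} \<in> E) (rev (u # q1 @ [w]))"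
        by (simp only: successively_rev_edge)
      hence s2: "successively (\<lambda>x y. {x, y} \<in> E) ((w # rev q1) @ [u])" by simp
      have "graph_cycle E ?c"
        unfolding graph_cycle_def
      proof (intro conjI)
        \<comment> \<open>\<open>p1\<close> and \<open>q1\<close> cannot both be empty, since then
          both paths would continue with \<open>w\<close>.\<close>
        show "length ?c \<ge> 3"
          using hd unfolding w(1) q12 by (cases p1; cases q1) auto
        show "distinct ?c"
          using p(3) q(2) w(3) unfolding w(1) q12 by auto
        have "successively (\<lambda>x y. {x, y} \<in> E) ((u # p1) @ (w # rev q1))"
          using s1 s2 by (simp only: successively_append_iff list.simps list.sel)
        thus "successively (\<lambda>x y. {x, y} \<in> E) ?c" by simp
        have "{last (w # rev q1), u} \<in> E"
          using s2 by (simp only: successively_append_iff) simp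
        thus "{last ?c, hd ?c} \<in> E" by simp
      qed
      thus False using acyclic by blast
    qed
    hence "path_between E (hd p) v p" "path_between E (hd p) v q'"
      using p q ne by (auto simp: path_between_def successively_Cons)
    hence "p = q'" by (rule Cons.IH)
    thus ?thesis using qq p by simp
  qed
qed

lemma level_eq:
  assumes "\<nexists>c. graph_cycle E c" "path_between E \<rho> v p"
  shows "level E \<rho> v = length p - 1"
proof -
  have "(THE p. path_between E \<rho> v p) = p"
    by (rule the_equality, rule assms(2)) (rule path_unique[OF assms(1) _ assms(2)])
  thus ?thesis by (simp add: level_def)
qed

text \<open>If \<open>v\<close> lay on the root path of \<open>u\<close>, its own root path would be
  an initial part of that one, and its level would not exceed that of \<open>u\<close>.\<close>

lemma arc_path:
  assumes tree: "is_tree E" and uv: "arc E \<rho> u v"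
  shows "\<exists>p. path_between E \<rho> u p \<and> path_between E \<rho> v (p @ [v])"
proof -
  have acyc: "\<nexists>c. graph_cycle E c" using tree by (simp add: is_tree_def)
  have "\<forall>u v. \<exists>p. path_between E u v p" using tree unfolding is_tree_def by (elim conjE)
  then obtain p where p: "path_between E \<rho> u p" by blast
  have "v \<notin> set p"
  proof
    assume "v \<in> set p"
    \<comment> \<open>Here \<open>relations\<close> names the part of the list behind
      \<open>v\<close>.\<close>
    then obtain ys relations where yz: "p = ys @ v # relations" by (meson split_list)
    have "path_between E \<rho> v (ys @ [v])"
      using p unfolding yz by (auto simp: path_between_def successively_append_iff hd_append)
    hence "level E \<rho> v \<le> level E \<rho> u"
      using level_eq[OF acyc] p yz by fastforce
    thus False using uv by (simp add: arc_def)
  qed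
  hence "path_between E \<rho> v (p @ [v])"
    using p uv by (auto simp: path_between_def successively_append_iff arc_def hd_append)
  thus ?thesis using p by blast
qed

text \<open>Both root paths to \<open>v\<close> coincide, hence so do their last vertices but
  one.\<close>

lemma arc_unique:
  assumes tree: "is_tree E" and "arc E \<rho> u v" "arc E \<rho> u' v"
  shows "u = u'"
proof -
  have acyc: "\<nexists>c. graph_cycle E c" using tree by (simp add: is_tree_def)
  obtain p p' where p: "path_between E \<rho> u p" "path_between E \<rho> v (p @ [v])"
      and p': "path_between E \<rho> u' p'" "path_between E \<rho> v (p' @ [v])"
    using arc_path[OF tree assms(2)] arc_path[OF tree assms(3)] by blast
  have "p @ [v] = p' @ [v]" by (rule path_unique[OF acyc p(2) p'(2)])
  thus ?thesis using p(1) p'(1) by (simp add: path_between_def)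
qed

text \<open>Levels increase strictly along a directed path, so a level bound cuts out an initial
  segment; this identifies the sets in \<open>nested\<close>.\<close>

lemma directed_path_below:
  assumes "directed_path E \<rho> (p1 @ b # p2)"
  shows "{v \<in> set (p1 @ b # p2). level E \<rho> v \<le> level E \<rho> b} = insert b (set p1)"
proof -
  have "successively (\<lambda>x y. level E \<rho> x < level E \<rho> y) (p1 @ b # p2)"
    using assms unfolding directed_path_def by (auto simp: arc_def elim: successively_mono)
  moreover have "transp (\<lambda>x y. level E \<rho> x < level E \<rho> y)" by (auto simp: transp_def)
  ultimately have "sorted_wrt (\<lambda>x y. level E \<rho> x < level E \<rho> y) (p1 @ b # p2)"
    by (simp add: successively_conv_sorted_wrt)
  thus ?thesis by (fastforce simp: sorted_wrt_append)
qed

text \<open>Going backwards from \<open>b\<close>, each predecessor is forced, so the shorter list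
  is the end of the longer one.\<close>

lemma arc_paths_nested:
  assumes tree: "is_tree E"
    and "successively (arc E \<rho>) (p @ [b])" "successively (arc E \<rho>) (q @ [b])" "length p \<le> length q"
  shows "set p \<subseteq> set q"
  using assms(2-)
proof (induction p arbitrary: b q rule: rev_induct)
  case (snoc x p)
  then obtain y q' where q: "q = q' @ [y]" by (cases q rule: rev_cases) auto
  have "arc E \<rho> x b" "arc E \<rho> y b"
    using snoc.prems unfolding q by (auto simp: successively_append_iff)
  hence "x = y" by (rule arc_unique[OF tree])
  moreover have "set p \<subseteq> set q'"
    using snoc.prems \<open>x = y\<close> unfolding q by (intro snoc.IH[of x]) (auto simp: successively_append_iff)
  ultimately show ?case using q by auto
qed simp

lemma nested_directed_paths:
  assumes tree: "is_tree E"
  shows "nested (level E \<rho>) {set p |p. directed_path E \<rho> p \<and> length p = t}"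
proof (rule nestedI)
  let ?lev = "level E \<rho>"
  fix P Q b assume "P \<in> {set p |p. directed_path E \<rho> p \<and> length p = t}"
    and "Q \<in> {set p |p. directed_path E \<rho> p \<and> length p = t}" and b: "b \<in> P" "b \<in> Q"
  then obtain p q where P: "P = set p" "directed_path E \<rho> p" and Q: "Q = set q" "directed_path E \<rho> q"
    by auto
  obtain p1 p2 q1 q2 where pq: "p = p1 @ b # p2" "q = q1 @ b # q2"
    using b unfolding P(1) Q(1) by (meson split_list)
  have "successively (arc E \<rho>) (p1 @ [b])" "successively (arc E \<rho>) (q1 @ [b])"
    using P(2) Q(2) unfolding pq directed_path_def by (auto simp: successively_append_iff)
  hence "set p1 \<subseteq> set q1 \<or> set q1 \<subseteq> set p1"
    using arc_paths_nested[OF tree] by (meson nle_le)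
  moreover have "{v\<in>P. ?lev v \<le> ?lev b} = insert b (set p1)"
    unfolding P(1) pq using P(2) unfolding pq by (rule directed_path_below)
  moreover have "{v\<in>Q. ?lev v \<le> ?lev b} = insert b (set q1)"
    unfolding Q(1) pq using Q(2) unfolding pq by (rule directed_path_below)
  ultimately show "{v\<in>P. ?lev v \<le> ?lev b} \<subseteq> {v\<in>Q. ?lev v \<le> ?lev b} \<or>
      {v\<in>Q. ?lev v \<le> ?lev b} \<subseteq> {v\<in>P. ?lev v \<le> ?lev b}"
    by auto
qed

theorem theorem2p24:
  fixes E :: "'v::finite set set" and \<rho> :: 'v and t :: nat
  assumes "is_tree E"
    and "1 \<le> t" and "t \<le> tree_height E \<rho> + 1"
  shows "subadditivity_holds
           (quotient_module (path_ideal t E \<rho> :: ('v, 'k::field) mpoly set))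
           (quotient_grading (path_ideal t E \<rho> :: ('v, 'k) mpoly set))"
  unfolding path_ideal_eq by (rule subadditivity_sqfree_ideal[OF nested_directed_paths[OF assms(1)]])

end
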